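(* The following data form a strict 2-category, denoted $\mathbf{2SVect}_{cc}$. Objects: the natural numbers $n\ge0$. 1-morphisms: for $n,m\ge1$, a 1-morphism $n\to m$ is a pair $(\mathbf R,s)$ where (i) $\mathbf R=(R_{ij})$ is an $m\times n$ matrix with entries in $\mathbb N$; (ii) $s=\{(s_1(\mathbf a),\dots,s_m(\mathbf a))\}_{\mathbf a\in\mathbb N^n}$ with $s_i(\mathbf a)$ an invertible complex matrix of size $\mathbf R(\mathbf a)_i\times\mathbf R(\mathbf a)_i$ if $\mathbf R(\mathbf a)_i\ne0$ and $s_i(\mathbf a)=1$ (trivial) otherwise, such that $s_i(\mathbf e_j)=\mathrm{Id}_{R_{ij}}$ whenever $R_{ij}\ne0$. If $n=0$ or $m=0$ there is exactly one 1-morphism $\mathbf 0_{n,m}:n\to m$. 2-morphisms: for $n,m\ge1$ and $(\mathbf R,s),(\mathbf R',s'):n\to m$, a 2-morphism $(\mathbf R,s)\Rightarrow(\mathbf R',s')$ is an $m\times n$ matrix $\mathsf T$ whose entry $\mathsf T_{ij}$ is an $R'_{ij}\times R_{ij}$ complex matrix if $R_{ij},R'_{ij}\ne0$ and empty otherwise. If $n=0$ or $m=0$ there is a unique 2-morphism $\mathbf 0_{n,m}\Rightarrow\mathbf 0_{n,m}$. Composition of 1-morphisms: for $n,m,p\ge1$, $(\mathbf R,s):n\to m$ and $(\widetilde{\mathbf R},\widetilde s):m\to p$, $(\widetilde{\mathbf R},\widetilde s)\circ(\mathbf R,s)=(\widetilde{\mathbf R}\mathbf R,\widetilde s\ast s)$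 with $$(\widetilde s\ast s)_k(\mathbf a)=\widetilde s_k(\mathbf R(\mathbf a))\left(\bigoplus_{i=1}^m\mathrm{Id}_{\widetilde R_{ki}}\otimes s_i(\mathbf a)\right)\mathbf P(\widetilde{\mathbf R}_k,\mathbf R,\mathbf a)\left(\bigoplus_{j=1}^n\widetilde s_k(\mathbf R(\mathbf e_j))^{-1}\otimes\mathrm{Id}_{a_j}\right)$$ for $\mathbf a\in\mathbb N^n$, $k=1,\dots,p$. If one of $n,m,p$ is zero, the composite is the zero 1-morphism $n\to p$. Vertical composition: for $\mathsf T:(\mathbf R,s)\Rightarrow(\mathbf R',s')$ and $\mathsf T':(\mathbf R',s')\Rightarrow(\mathbf R'',s'')$, $(\mathsf T'\cdot\mathsf T)_{ij}=\mathsf T'_{ij}\mathsf T_{ij}$, $i=1,\dots,m$, $j=1,\dots,n$. Horizontal composition: for $\mathsf T:(\mathbf R,s)\Rightarrow(\mathbf R',s'):n\to m$ and $\widetilde{\mathsf T}:(\widetilde{\mathbf R},\widetilde s)\Rightarrow(\widetilde{\mathbf R}',\widetilde s'):m\to p$ with $n,m,p\ge1$, $$(\widetilde{\mathsf T}\circ\mathsf T)_{kj}=\widetilde s'_k(\mathbf R'(\mathbf e_j))\left(\bigoplus_{i=1}^m\widetilde{\mathsf T}_{ki}\otimes\mathsf T_{ij}\right)\widetilde s_k(\mathbf R(\mathbf e_j))^{-1},\qquad j=1,\dots,n,\ k=1,\dots,p.$$ The identity 1-morphism of $n\ge1$ is $(\mathrm{Id}_n,1)$, where $1$ denotes the trivial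 gauge (all $s_i(\mathbf a)$ identity matrices), and the identity 2-morphism of $(\mathbf R,s)$ has entries $\mathrm{Id}_{R_{ij}}$ if $R_{ij}\neq0$ and empty otherwise.
   Context: $\mathbb N=\{0,1,2,\dots\}$. $\mathbf R(\mathbf a)$ is the product of the matrix $\mathbf R$ with the column vector $\mathbf a$, $\mathbf R(\mathbf a)_i$ its $i$-th entry; $\mathbf e_j$ is the $j$-th canonical basis vector; $\mathbf R_k$ is the $k$-th row of $\mathbf R$. $\bigoplus$ of matrices is the block diagonal sum and $\otimes$ the Kronecker product (blocks $M_{uv}N$), so $\mathrm{Id}_r\otimes M$ is block diagonal with $r$ copies of $M$. Conventions for empty matrices: an "empty" entry in position $(i,j)$ of a 2-morphism is regarded as the unique $R'_{ij}\times R_{ij}$ matrix when $R_{ij}=0$ or $R'_{ij}=0$; products, Kronecker products and direct sums are taken keeping track of sizes. Thus the product of a $p\times0$ by a $0\times q$ matrix is the $p\times q$ zero matrix, and in a direct sum a $p\times0$ block contributes $p$ zero rows and a $0\times q$ block contributes $q$ zero columns. For $n,p\ge1$ the zero 1-morphism $n\to p$ is the pair with zero rank matrix and trivial gauge. Compositions of 2-morphisms involving the object $0$ are the only possible ones: the target set of 2-morphisms has a unique element. Permutation matrices: for $\mathbf r'\in\mathbb N^m$, $\mathbf R$ an $m\times n$ matrix over $\mathbb N$ and $\mathbf a\in\mathbb N^n$, put $\tilde r_j=\sum_ir'_iR_{ij}$. $\mathbf P(\mathbf r',\mathbf R,\mathbf a)$ is the permutation matrix of order $\sum_j\tilde r_ja_j$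 such that, for all square matrices $M_1,\dots,M_n$ of sizes $a_1,\dots,a_n$, conjugation $M\mapsto\mathbf PM\mathbf P^{-1}$ takes $\bigoplus_{j=1}^n\mathrm{Id}_{\tilde r_j}\otimes M_j$ to $\bigoplus_{i=1}^m\mathrm{Id}_{r'_i}\otimes\big(\bigoplus_{j=1}^n\mathrm{Id}_{R_{ij}}\otimes M_j\big)$ by moving whole diagonal blocks without changing the relative order of the various copies of $M_j$, for each $j$. Explicitly: index the source basis by $(j,t,x)$, $1\le j\le n$, $1\le t\le\tilde r_j$, $1\le x\le a_j$, and the target basis by $(i,u,j,v,x)$, $1\le i\le m$, $1\le u\le r'_i$, $1\le j\le n$, $1\le v\le R_{ij}$, $1\le x\le a_j$, both ordered lexicographically; $\mathbf P$ sends the basis vector $(j,t,x)$ to $(i,u,j,v,x)$, where, for that $j$, $(i,u,v)$ is the $t$-th triple in lexicographic order among those with $1\le u\le r'_i$, $1\le v\le R_{ij}$. *)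

theory Defs
  imports
    Complex_Main
    "HOL-Library.FuncSet"
    "Jordan_Normal_Form.Matrix"
    "Jordan_Normal_Form.Gauss_Jordan_Elimination"
begin

section \<open>Strict 2-categories\<close>

text \<open>
  Hom-sets are indexed families: \<open>Hom1 x y\<close> are the 1-morphisms \<open>x \<rightarrow> y\<close>, and \<open>Hom2 x y f f'\<close>
  are the 2-morphisms \<open>f \<Rightarrow> f'\<close> between 1-morphisms \<open>x \<rightarrow> y\<close>. Since a morphism need not determine
  its source and target, identities and compositions take these as arguments:
  \<open>comp1 x y z g f\<close> is \<open>g \<circ> f\<close> for \<open>f : x \<rightarrow> y\<close>, \<open>g : y \<rightarrow> z\<close>;
  \<open>vcomp x y f f' f'' \<beta> \<alpha>\<close> is \<open>\<beta> \<cdot> \<alpha>\<close> for \<open>\<alpha> : f \<Rightarrow> f'\<close>, \<open>\<beta> : f' \<Rightarrow> f''\<close>;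
  \<open>hcomp x y z g g' f f' \<beta> \<alpha>\<close> is \<open>\<beta> \<circ> \<alpha>\<close> for \<open>\<alpha> : f \<Rightarrow> f' : x \<rightarrow> y\<close>, \<open>\<beta> : g \<Rightarrow> g' : y \<rightarrow> z\<close>.
\<close>

locale strict_2_category =
  fixes Obj :: "'o set"
    and Hom1 :: "'o \<Rightarrow> 'o \<Rightarrow> 'f set"
    and Hom2 :: "'o \<Rightarrow> 'o \<Rightarrow> 'f \<Rightarrow> 'f \<Rightarrow> 't set"
    and id1 :: "'o \<Rightarrow> 'f"
    and comp1 :: "'o \<Rightarrow> 'o \<Rightarrow> 'o \<Rightarrow> 'f \<Rightarrow> 'f \<Rightarrow> 'f"
    and id2 :: "'o \<Rightarrow> 'o \<Rightarrow> 'f \<Rightarrow> 't"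
    and vcomp :: "'o \<Rightarrow> 'o \<Rightarrow> 'f \<Rightarrow> 'f \<Rightarrow> 'f \<Rightarrow> 't \<Rightarrow> 't \<Rightarrow> 't"
    and hcomp :: "'o \<Rightarrow> 'o \<Rightarrow> 'o \<Rightarrow> 'f \<Rightarrow> 'f \<Rightarrow> 'f \<Rightarrow> 'f \<Rightarrow> 't \<Rightarrow> 't \<Rightarrow> 't"
  assumes id1_closed:
      "x \<in> Obj \<Longrightarrow> id1 x \<in> Hom1 x x"
    and comp1_closed:
      "\<lbrakk>x \<in> Obj; y \<in> Obj; z \<in> Obj; f \<in> Hom1 x y; g \<in> Hom1 y z\<rbrakk>
       \<Longrightarrow> comp1 x y z g f \<in> Hom1 x z"
    and comp1_assoc:
      "\<lbrakk>w \<in> Obj; x \<in> Obj; y \<in> Obj; z \<in> Obj; f \<in> Hom1 w x; g \<in> Hom1 x y; h \<in> Hom1 y z\<rbrakk>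
       \<Longrightarrow> comp1 w x z (comp1 x y z h g) f = comp1 w y z h (comp1 w x y g f)"
    and comp1_id_left:
      "\<lbrakk>x \<in> Obj; y \<in> Obj; f \<in> Hom1 x y\<rbrakk> \<Longrightarrow> comp1 x y y (id1 y) f = f"
    and comp1_id_right:
      "\<lbrakk>x \<in> Obj; y \<in> Obj; f \<in> Hom1 x y\<rbrakk> \<Longrightarrow> comp1 x x y f (id1 x) = f"
    and id2_closed:
      "\<lbrakk>x \<in> Obj; y \<in> Obj; f \<in> Hom1 x y\<rbrakk> \<Longrightarrow> id2 x y f \<in> Hom2 x y f f"
    and vcomp_closed:
      "\<lbrakk>x \<in> Obj; y \<in> Obj; f \<in> Hom1 x y; f' \<in> Hom1 x y; f'' \<in> Hom1 x y;
        \<alpha> \<in> Hom2 x y f f'; \<beta> \<in> Hom2 x y f' f''\<rbrakk>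
       \<Longrightarrow> vcomp x y f f' f'' \<beta> \<alpha> \<in> Hom2 x y f f''"
    and vcomp_assoc:
      "\<lbrakk>x \<in> Obj; y \<in> Obj;
        f \<in> Hom1 x y; f' \<in> Hom1 x y; f'' \<in> Hom1 x y; f''' \<in> Hom1 x y;
        \<alpha> \<in> Hom2 x y f f'; \<beta> \<in> Hom2 x y f' f''; \<gamma> \<in> Hom2 x y f'' f'''\<rbrakk>
       \<Longrightarrow> vcomp x y f f' f''' (vcomp x y f' f'' f''' \<gamma> \<beta>) \<alpha>
         = vcomp x y f f'' f''' \<gamma> (vcomp x y f f' f'' \<beta> \<alpha>)"
    and vcomp_id_left:
      "\<lbrakk>x \<in> Obj; y \<in> Obj; f \<in> Hom1 x y; f' \<in> Hom1 x y; \<alpha> \<in> Hom2 x y f f'\<rbrakk>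
       \<Longrightarrow> vcomp x y f f' f' (id2 x y f') \<alpha> = \<alpha>"
    and vcomp_id_right:
      "\<lbrakk>x \<in> Obj; y \<in> Obj; f \<in> Hom1 x y; f' \<in> Hom1 x y; \<alpha> \<in> Hom2 x y f f'\<rbrakk>
       \<Longrightarrow> vcomp x y f f f' \<alpha> (id2 x y f) = \<alpha>"
    and hcomp_closed:
      "\<lbrakk>x \<in> Obj; y \<in> Obj; z \<in> Obj;
        f \<in> Hom1 x y; f' \<in> Hom1 x y; g \<in> Hom1 y z; g' \<in> Hom1 y z;
        \<alpha> \<in> Hom2 x y f f'; \<beta> \<in> Hom2 y z g g'\<rbrakk>
       \<Longrightarrow> hcomp x y z g g' f f' \<beta> \<alpha> \<in> Hom2 x z (comp1 x y z g f) (comp1 x y z g' f')"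
    and hcomp_id2:
      "\<lbrakk>x \<in> Obj; y \<in> Obj; z \<in> Obj; f \<in> Hom1 x y; g \<in> Hom1 y z\<rbrakk>
       \<Longrightarrow> hcomp x y z g g f f (id2 y z g) (id2 x y f) = id2 x z (comp1 x y z g f)"
    and interchange:
      "\<lbrakk>x \<in> Obj; y \<in> Obj; z \<in> Obj;
        f \<in> Hom1 x y; f' \<in> Hom1 x y; f'' \<in> Hom1 x y;
        g \<in> Hom1 y z; g' \<in> Hom1 y z; g'' \<in> Hom1 y z;
        \<alpha> \<in> Hom2 x y f f'; \<alpha>' \<in> Hom2 x y f' f'';
        \<beta> \<in> Hom2 y z g g'; \<beta>' \<in> Hom2 y z g' g''\<rbrakk>
       \<Longrightarrow> hcomp x y z g g'' f f'' (vcomp y z g g' g'' \<beta>' \<beta>) (vcomp x y f f' f'' \<alpha>' \<alpha>)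
         = vcomp x z (comp1 x y z g f) (comp1 x y z g' f') (comp1 x y z g'' f'')
             (hcomp x y z g' g'' f' f'' \<beta>' \<alpha>') (hcomp x y z g g' f f' \<beta> \<alpha>)"
    and hcomp_assoc:
      "\<lbrakk>w \<in> Obj; x \<in> Obj; y \<in> Obj; z \<in> Obj;
        f \<in> Hom1 w x; f' \<in> Hom1 w x; g \<in> Hom1 x y; g' \<in> Hom1 x y; h \<in> Hom1 y z; h' \<in> Hom1 y z;
        \<alpha> \<in> Hom2 w x f f'; \<beta> \<in> Hom2 x y g g'; \<gamma> \<in> Hom2 y z h h'\<rbrakk>
       \<Longrightarrow> hcomp w x z (comp1 x y z h g) (comp1 x y z h' g') f f'
             (hcomp x y z h h' g g' \<gamma> \<beta>) \<alpha>
         = hcomp w y z h h' (comp1 w x y g f) (comp1 w x y g' f')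
             \<gamma> (hcomp w x y g g' f f' \<beta> \<alpha>)"
    and hcomp_id_left:
      "\<lbrakk>x \<in> Obj; y \<in> Obj; f \<in> Hom1 x y; f' \<in> Hom1 x y; \<alpha> \<in> Hom2 x y f f'\<rbrakk>
       \<Longrightarrow> hcomp x y y (id1 y) (id1 y) f f' (id2 y y (id1 y)) \<alpha> = \<alpha>"
    and hcomp_id_right:
      "\<lbrakk>x \<in> Obj; y \<in> Obj; f \<in> Hom1 x y; f' \<in> Hom1 x y; \<alpha> \<in> Hom2 x y f f'\<rbrakk>
       \<Longrightarrow> hcomp x x y f f' (id1 x) (id1 x) \<alpha> (id2 x x (id1 x)) = \<alpha>"


section \<open>Matrix operations\<close>

text \<open>
  Indices are 0-based throughout. Matrices carry their sizes, including \<open>p \<times> 0\<close> and \<open>0 \<times> q\<close>, so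
  products, \<open>kron\<close> and \<open>diag_block_mat\<close> follow the size-tracking conventions for empty matrices.
\<close>

definition kron :: "'a::times mat \<Rightarrow> 'a mat \<Rightarrow> 'a mat" where
  "kron A B = mat (dim_row A * dim_row B) (dim_col A * dim_col B)
     (\<lambda>(i, j). A $$ (i div dim_row B, j div dim_col B) * B $$ (i mod dim_row B, j mod dim_col B))"

definition dsum :: "nat \<Rightarrow> (nat \<Rightarrow> 'a::zero mat) \<Rightarrow> 'a mat" where
  "dsum n A = diag_block_mat (map A [0..<n])"

abbreviation minv :: "'a::field mat \<Rightarrow> 'a mat" where
  "minv A \<equiv> the (mat_inverse A)"

text \<open>
  The permutation matrix \<open>P(r', R, a)\<close>. Nested list comprehensions enumerate tuples in
  lexicographic order: \<open>perm_src\<close> lists the \<open>(j,t,x)\<close>, \<open>perm_tgt\<close> the \<open>(i,u,j,v,x)\<close>, and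
  \<open>perm_copies r' R j\<close> the \<open>(i,u,v)\<close> belonging to \<open>j\<close>.
\<close>

definition perm_mult :: "nat vec \<Rightarrow> nat mat \<Rightarrow> nat \<Rightarrow> nat" where
  "perm_mult r R j = (\<Sum>i<dim_row R. r $ i * R $$ (i, j))"

definition perm_copies :: "nat vec \<Rightarrow> nat mat \<Rightarrow> nat \<Rightarrow> (nat \<times> nat \<times> nat) list" where
  "perm_copies r R j = [(i, u, v). i \<leftarrow> [0..<dim_row R], u \<leftarrow> [0..<r $ i], v \<leftarrow> [0..<R $$ (i, j)]]"

definition perm_src :: "nat vec \<Rightarrow> nat mat \<Rightarrow> nat vec \<Rightarrow> (nat \<times> nat \<times> nat) list" where
  "perm_src r R a =
     [(j, t, x). j \<leftarrow> [0..<dim_col R], t \<leftarrow> [0..<perm_mult r R j], x \<leftarrow> [0..<a $ j]]"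

definition perm_tgt :: "nat vec \<Rightarrow> nat mat \<Rightarrow> nat vec \<Rightarrow> (nat \<times> nat \<times> nat \<times> nat \<times> nat) list" where
  "perm_tgt r R a =
     [(i, u, j, v, x). i \<leftarrow> [0..<dim_row R], u \<leftarrow> [0..<r $ i],
                       j \<leftarrow> [0..<dim_col R], v \<leftarrow> [0..<R $$ (i, j)], x \<leftarrow> [0..<a $ j]]"

definition perm_mat :: "nat vec \<Rightarrow> nat mat \<Rightarrow> nat vec \<Rightarrow> complex mat" where
  "perm_mat r R a =
     (let N = (\<Sum>j<dim_col R. perm_mult r R j * a $ j) in
      mat N N (\<lambda>(p, q).
        case perm_src r R a ! q of (j, t, x) \<Rightarrow>
        case perm_copies r R j ! t of (i, u, v) \<Rightarrow>
          if perm_tgt r R a ! p = (i, u, j, v, x) then 1 else 0))"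


section \<open>The data of \<open>2SVect\<^sub>c\<^sub>c\<close>\<close>

text \<open>
  A gauge sends \<open>a\<close> in \<open>\<nat>\<^sup>n\<close> to the tuple \<open>(s\<^sub>1(a), \<dots>, s\<^sub>m(a))\<close>; it is taken extensional on
  \<open>carrier_vec n\<close>, so that equality of 1-morphisms is equality of families over \<open>\<nat>\<^sup>n\<close>.
\<close>

type_synonym gauge = "nat vec \<Rightarrow> complex mat vec"
type_synonym mor1 = "nat mat \<times> gauge"
type_synonym mor2 = "complex mat mat"

definition trivial_gauge :: "nat mat \<Rightarrow> gauge" where
  "trivial_gauge R = (\<lambda>a\<in>carrier_vec (dim_col R). vec (dim_row R) (\<lambda>i. 1\<^sub>m ((R *\<^sub>v a) $ i)))"

text \<open>
  \<open>zero1 n m\<close> is the zero 1-morphism \<open>n \<rightarrow> m\<close>, for all \<open>n, m \<ge> 0\<close>; \<open>zero2 n m\<close> is the only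
  2-morphism from it to itself. The trivial \<open>s\<^sub>i(a) = 1\<close> in rank 0 is the \<open>0 \<times> 0\<close> matrix.
\<close>

definition zero1 :: "nat \<Rightarrow> nat \<Rightarrow> mor1" where
  "zero1 n m = (0\<^sub>m m n, trivial_gauge (0\<^sub>m m n))"

definition zero2 :: "nat \<Rightarrow> nat \<Rightarrow> mor2" where
  "zero2 n m = mat m n (\<lambda>_. 1\<^sub>m 0)"

definition is_gauge :: "nat \<Rightarrow> nat \<Rightarrow> nat mat \<Rightarrow> gauge \<Rightarrow> bool" where
  "is_gauge n m R s \<longleftrightarrow>
     s \<in> carrier_vec n \<rightarrow>\<^sub>E carrier_vec m \<and>
     (\<forall>a\<in>carrier_vec n. \<forall>i<m.
        if (R *\<^sub>v a) $ i \<noteq> 0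
        then s a $ i \<in> carrier_mat ((R *\<^sub>v a) $ i) ((R *\<^sub>v a) $ i) \<and> invertible_mat (s a $ i)
        else s a $ i = 1\<^sub>m 0) \<and>
     (\<forall>i<m. \<forall>j<n. R $$ (i, j) \<noteq> 0 \<longrightarrow> s (unit_vec n j) $ i = 1\<^sub>m (R $$ (i, j)))"

definition hom1 :: "nat \<Rightarrow> nat \<Rightarrow> mor1 set" where
  "hom1 n m =
     (if n = 0 \<or> m = 0 then {zero1 n m}
      else {(R, s). R \<in> carrier_mat m n \<and> is_gauge n m R s})"

text \<open>
  An empty entry of a 2-morphism is the unique \<open>R'\<^sub>i\<^sub>j \<times> R\<^sub>i\<^sub>j\<close> matrix with \<open>R'\<^sub>i\<^sub>j = 0\<close> or \<open>R\<^sub>i\<^sub>j = 0\<close>.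
\<close>

definition hom2 :: "nat \<Rightarrow> nat \<Rightarrow> mor1 \<Rightarrow> mor1 \<Rightarrow> mor2 set" where
  "hom2 n m = (\<lambda>(R, s) (R', s').
     if n = 0 \<or> m = 0 then {zero2 n m}
     else {T \<in> carrier_mat m n.
             \<forall>i<m. \<forall>j<n. T $$ (i, j) \<in> carrier_mat (R' $$ (i, j)) (R $$ (i, j))})"

definition id_mor1 :: "nat \<Rightarrow> mor1" where
  "id_mor1 n = (if n = 0 then zero1 0 0 else (1\<^sub>m n, trivial_gauge (1\<^sub>m n)))"

definition id_mor2 :: "nat \<Rightarrow> nat \<Rightarrow> mor1 \<Rightarrow> mor2" where
  "id_mor2 n m = (\<lambda>(R, s).
     if n = 0 \<or> m = 0 then zero2 n m else mat m n (\<lambda>(i, j). 1\<^sub>m (R $$ (i, j))))"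

definition gauge_comp :: "nat \<Rightarrow> nat \<Rightarrow> nat \<Rightarrow> mor1 \<Rightarrow> mor1 \<Rightarrow> gauge" where
  "gauge_comp n m p = (\<lambda>(R', s') (R, s).
     \<lambda>a\<in>carrier_vec n. vec p (\<lambda>k.
       s' (R *\<^sub>v a) $ k
       * dsum m (\<lambda>i. kron (1\<^sub>m (R' $$ (k, i))) (s a $ i))
       * perm_mat (row R' k) R a
       * dsum n (\<lambda>j. kron (minv (s' (R *\<^sub>v unit_vec n j) $ k)) (1\<^sub>m (a $ j)))))"

definition comp_mor1 :: "nat \<Rightarrow> nat \<Rightarrow> nat \<Rightarrow> mor1 \<Rightarrow> mor1 \<Rightarrow> mor1" where
  "comp_mor1 n m p g f =
     (if n = 0 \<or> m = 0 \<or> p = 0 then zero1 n p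
      else (fst g * fst f, gauge_comp n m p g f))"

definition vcomp_mor2 :: "nat \<Rightarrow> nat \<Rightarrow> mor1 \<Rightarrow> mor1 \<Rightarrow> mor1 \<Rightarrow> mor2 \<Rightarrow> mor2 \<Rightarrow> mor2" where
  "vcomp_mor2 n m f f' f'' T' T =
     (if n = 0 \<or> m = 0 then zero2 n m
      else mat m n (\<lambda>(i, j). T' $$ (i, j) * T $$ (i, j)))"

definition hcomp_mor2 ::
  "nat \<Rightarrow> nat \<Rightarrow> nat \<Rightarrow> mor1 \<Rightarrow> mor1 \<Rightarrow> mor1 \<Rightarrow> mor1 \<Rightarrow> mor2 \<Rightarrow> mor2 \<Rightarrow> mor2" where
  "hcomp_mor2 n m p = (\<lambda>(Rg, sg) (Rg', sg') (Rf, sf) (Rf', sf') Tg Tf.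
     if n = 0 \<or> m = 0 \<or> p = 0 then zero2 n p
     else mat p n (\<lambda>(k, j).
       sg' (Rf' *\<^sub>v unit_vec n j) $ k
       * dsum m (\<lambda>i. kron (Tg $$ (k, i)) (Tf $$ (i, j)))
       * minv (sg (Rf *\<^sub>v unit_vec n j) $ k)))"

end

(*
  Index the rows and columns of all matrices by tuples of labels instead of initial segments of the
  naturals. Direct sums and Kronecker products then have entries indexed by (dependent) pairs, and
  P(r, R, a) becomes the 0/1 matrix of the bijection (j, (i, u, v), x) -> (i, u, j, v, x): it merely
  reorders labels. Two facts about it carry the whole proof. It is natural in the three families X_i,
  Y_ij, M_j of rectangular matrices between the two bracketings (+)_j ((+)_i X_i (x) Y_ij) (x) M_j and
  (+)_i X_i (x) ((+)_j Y_ij (x) M_j); and it is coherent, i.e. the two ways of regrouping the labels of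
  a triple composite agree. Associativity of * follows by moving every gauge factor through the
  permutations by naturality and then applying coherence; for horizontal associativity naturality alone
  suffices, the inner gauge factors cancelling in pairs.
*)

theory Submission
  imports Defs
begin

section \<open>Matrices with labelled rows and columns\<close>

text \<open>Strictness means that both sides of every law are equal matrices, so the position of
  each entry matters. In coordinates this would be \<open>div\<close>/\<open>mod\<close> arithmetic
  with block sizes varying from block to block; labels avoid it, and they are kept in lists rather
  than sets because the order of a list fixes the positions. The ranks of a triple composite are
  labelled by tuples again, and right-nested tuples need no reassociation:
  \<open>(k, u, i, v, (j, w, x))\<close> already is \<open>(k, u, i, v, j, w, x)\<close>. Coherence
  thus becomes an equality of two functions on tuples. The last factor of a composite gauge, built
  from inverse values of the outer gauge at the columns R(e_j), restores the normalisation at unit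
  vectors. It is also the obstacle to associativity: in a triple composite such inverses sit inside
  nested gauges, on the wrong side of a permutation. Pairs of mutually inverse factors have to be
  inserted before naturality can carry them across and coherence can be applied.\<close>

definition dep_prod :: "'a list \<Rightarrow> ('a \<Rightarrow> 'b list) \<Rightarrow> ('a \<times> 'b) list" where
  "dep_prod L K = concat (map (\<lambda>x. map (Pair x) (K x)) L)"

lemma dep_prod_Nil [simp]: "dep_prod [] K = []"
  and dep_prod_Cons [simp]: "dep_prod (x # L) K = map (Pair x) (K x) @ dep_prod L K"
  by (simp_all add: dep_prod_def)

lemma set_dep_prod [simp]: "set (dep_prod L K) = (SIGMA x:set L. set (K x))"
  by (auto simp: dep_prod_def)

lemma fst_dep_prod_nth: "p < length (dep_prod L K) \<Longrightarrow> fst (dep_prod L K ! p) \<in> set L"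
  by (metis SigmaE fst_conv nth_mem set_dep_prod)

lemma distinct_dep_prod [simp]:
  "distinct L \<Longrightarrow> (\<And>x. x \<in> set L \<Longrightarrow> distinct (K x)) \<Longrightarrow> distinct (dep_prod L K)"
  by (induction L) (auto simp: distinct_map inj_on_def)

lemma length_dep_prod: "length (dep_prod L K) = (\<Sum>x\<leftarrow>L. length (K x))"
  by (induction L) auto

lemma length_dep_prod_upt [simp]: "length (dep_prod [0..<n] K) = (\<Sum>i<n. length (K i))"
  by (simp add: length_dep_prod interv_sum_list_conv_sum_set_nat atLeast0LessThan)

lemma length_dep_prod_const [simp]: "length (dep_prod L (\<lambda>_. K)) = length L * length K"
  by (simp add: length_dep_prod sum_list_triv)

lemma dep_prod_const: "dep_prod L (\<lambda>_. K) = List.product L K"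
  by (induction L) auto

text \<open>As a congruence rule it lets the simplifier use membership of the index while it
  rewrites a fibre.\<close>

lemma dep_prod_cong [cong]:
  "L = L' \<Longrightarrow> (\<And>x. x \<in> set L' \<Longrightarrow> K x = K' x) \<Longrightarrow> dep_prod L K = dep_prod L' K'"
  by (simp add: dep_prod_def cong: map_cong)

lemma dep_prod_map:
  "dep_prod (map f L) K = map (\<lambda>(x, y). (f x, y)) (dep_prod L (\<lambda>x. K (f x)))"
  by (induction L) auto

lemma dep_prod_map_snd:
  "dep_prod L (\<lambda>x. map (g x) (K x)) = map (\<lambda>(x, y). (x, g x y)) (dep_prod L K)"
  by (induction L) auto

lemma dep_prod_empty: "(\<And>x. x \<in> set L \<Longrightarrow> K x = []) \<Longrightarrow> dep_prod L K = []"
  by (induction L) auto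

text \<open>Unit vectors and identity matrices give ranges of length 0 or 1; this removes the index
  that they select.\<close>

lemma dep_prod_single:
  assumes "distinct L" "x \<in> set L" "\<And>y. y \<in> set L \<Longrightarrow> y \<noteq> x \<Longrightarrow> K y = []"
  shows "dep_prod L K = map (Pair x) (K x)"
  using assms
proof (induction L)
  case (Cons y L)
  show ?case
  proof (cases "y = x")
    case True
    then have "dep_prod L K = []"
      using Cons.prems by (intro dep_prod_empty) auto
    with True show ?thesis by simp
  next
    case False
    with Cons show ?thesis by auto
  qed
qed simp

text \<open>The lists fix sizes and positions, \<open>F\<close> the entries. Equality of two
  matrices over the same lists thereby reduces to equality of the entry functions on labels.\<close>

definition lab_mat :: "'i list \<Rightarrow> 'j list \<Rightarrow> ('i \<Rightarrow> 'j \<Rightarrow> 'a) \<Rightarrow> 'a mat" where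
  "lab_mat L K F = mat (length L) (length K) (\<lambda>(p, q). F (L ! p) (K ! q))"

lemma lab_mat_carrier [simp]: "lab_mat L K F \<in> carrier_mat (length L) (length K)"
  and dim_row_lab_mat [simp]: "dim_row (lab_mat L K F) = length L"
  and dim_col_lab_mat [simp]: "dim_col (lab_mat L K F) = length K"
  by (simp_all add: lab_mat_def)

lemma index_lab_mat [simp]:
  "p < length L \<Longrightarrow> q < length K \<Longrightarrow> lab_mat L K F $$ (p, q) = F (L ! p) (K ! q)"
  by (simp add: lab_mat_def)

lemma lab_mat_cong:
  assumes "L = L'" "K = K'" "\<And>x y. x \<in> set L' \<Longrightarrow> y \<in> set K' \<Longrightarrow> F x y = G x y"
  shows "lab_mat L K F = lab_mat L' K' G"
  using assms by (intro eq_matI) auto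

lemma lab_mat_map:
  "lab_mat (map f L) (map g K) F = lab_mat L K (\<lambda>x y. F (f x) (g y))"
  by (intro eq_matI) auto

lemma mat_eq_lab_mat:
  "A \<in> carrier_mat r c \<Longrightarrow> A = lab_mat [0..<r] [0..<c] (\<lambda>p q. A $$ (p, q))"
  by (intro eq_matI) auto

lemma one_mat_eq_lab_mat:
  "distinct L \<Longrightarrow> 1\<^sub>m (length L) = lab_mat L L (\<lambda>x y. if x = y then 1 else 0)"
  by (intro eq_matI) (auto simp: nth_eq_iff_index_eq)

text \<open>Distinctness of \<open>K\<close> turns the sum over positions in a scalar product into a
  sum over labels.\<close>

lemma lab_mat_mult:
  fixes F :: "'i \<Rightarrow> 'j \<Rightarrow> 'a::semiring_0"
  assumes "distinct K"
  shows "lab_mat L K F * lab_mat K M G = lab_mat L M (\<lambda>x z. \<Sum>y\<in>set K. F x y * G y z)"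
proof (intro eq_matI)
  fix p q assume "p < dim_row (lab_mat L M (\<lambda>x z. \<Sum>y\<in>set K. F x y * G y z))"
    "q < dim_col (lab_mat L M (\<lambda>x z. \<Sum>y\<in>set K. F x y * G y z))"
  moreover have "(\<Sum>y\<in>set K. F x y * G y z) = (\<Sum>i<length K. F x (K ! i) * G (K ! i) z)" for x z
    using sum.reindex_bij_betw[OF bij_betw_nth[OF assms refl refl], of "\<lambda>y. F x y * G y z"] by simp
  ultimately show "(lab_mat L K F * lab_mat K M G) $$ (p, q)
      = lab_mat L M (\<lambda>x z. \<Sum>y\<in>set K. F x y * G y z) $$ (p, q)"
    by (simp add: scalar_prod_def atLeast0LessThan)
qed auto

section \<open>Kronecker products and block sums in terms of labels\<close>

lemma kron_lab_mat:
  "kron (lab_mat L K F) (lab_mat L' K' G)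
   = lab_mat (dep_prod L (\<lambda>_. L')) (dep_prod K (\<lambda>_. K')) (\<lambda>(x, x') (y, y'). F x y * G x' y')"
proof (rule eq_matI)
  fix p q
  assume "p < dim_row (lab_mat (dep_prod L (\<lambda>_. L')) (dep_prod K (\<lambda>_. K'))
      (\<lambda>(x, x') (y, y'). F x y * G x' y'))"
    "q < dim_col (lab_mat (dep_prod L (\<lambda>_. L')) (dep_prod K (\<lambda>_. K'))
      (\<lambda>(x, x') (y, y'). F x y * G x' y'))"
  then have pq: "p < length L * length L'" "q < length K * length K'"
    by simp_all
  \<comment> \<open>An index below a product forces both factors to be positive, as the
    \<open>mod\<close> part of the index requires.\<close>
  then have "0 < length L'" "0 < length K'"
    by (auto intro: Nat.gr0I)
  with pq show "kron (lab_mat L K F) (lab_mat L' K' G) $$ (p, q) =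
    lab_mat (dep_prod L (\<lambda>_. L')) (dep_prod K (\<lambda>_. K')) (\<lambda>(x, x') (y, y'). F x y * G x' y') $$ (p, q)"
    by (simp add: kron_def dep_prod_const product_nth less_mult_imp_div_less)
qed (simp_all add: kron_def)

text \<open>A position in an off-diagonal block carries two different block labels because
  \<open>I\<close> is distinct; this is how the zero blocks are recognised.\<close>

lemma diag_block_mat_lab_mat:
  assumes "distinct I"
  shows "diag_block_mat (map (\<lambda>i. lab_mat (L i) (K i) (F i)) I)
   = lab_mat (dep_prod I L) (dep_prod I K) (\<lambda>(i, x) (i', y). if i = i' then F i x y else 0)"
  using assms
proof (induction I)
  case Nil
  show ?case by (intro eq_matI) auto
next
  case (Cons i I)
  \<comment> \<open>Past the first block the label comes from the tail list, hence differs from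
    \<open>i\<close>; \<open>ne'\<close> is the same for columns.\<close>
  have ne: "fst (dep_prod I L ! (p - length (L i))) \<noteq> i"
    if "p < length (L i) + length (dep_prod I L)" "\<not> p < length (L i)" for p
    proof -
    have "p - length (L i) < length (dep_prod I L)"
      using that by linarith
    from fst_dep_prod_nth[OF this] show ?thesis
      using Cons.prems by auto
  qed
  have ne': "i \<noteq> fst (dep_prod I K ! (p - length (K i)))"
    if "p < length (K i) + length (dep_prod I K)" "\<not> p < length (K i)" for p
    proof -
    have "p - length (K i) < length (dep_prod I K)"
      using that by linarith
    from fst_dep_prod_nth[OF this] show ?thesis
      using Cons.prems by auto
  qed
  have IH: "diag_block_mat (map (\<lambda>i. lab_mat (L i) (K i) (F i)) I)
   = lab_mat (dep_prod I L) (dep_prod I K) (\<lambda>p q. if fst p = fst q then F (fst p) (snd p) (snd q) else 0)"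
    using Cons by (simp add: case_prod_beta)
  show ?case
    apply (rule eq_matI)
    subgoal for p q
      by (simp add: IH Let_def nth_append case_prod_beta ne ne')
    by (auto simp: IH Let_def)
qed

lemma dsum_lab_mat:
  "dsum n (\<lambda>i. lab_mat (L i) (K i) (F i))
   = lab_mat (dep_prod [0..<n] L) (dep_prod [0..<n] K) (\<lambda>(i, x) (i', y). if i = i' then F i x y else 0)"
  unfolding dsum_def by (rule diag_block_mat_lab_mat) simp

section \<open>Direct sums and Kronecker products\<close>

lemma dsum_cong: "n = n' \<Longrightarrow> (\<And>i. i < n' \<Longrightarrow> A i = B i) \<Longrightarrow> dsum n A = dsum n' B"
  unfolding dsum_def by (auto intro!: arg_cong[where f=diag_block_mat])

lemma dim_dsum [simp]:
  "dim_row (dsum n A) = (\<Sum>i<n. dim_row (A i))" "dim_col (dsum n A) = (\<Sum>i<n. dim_col (A i))"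
  by (simp_all add: dsum_def dim_diag_block_mat interv_sum_list_conv_sum_set_nat atLeast0LessThan comp_def)

lemma dim_kron [simp]:
  "dim_row (kron A B) = dim_row A * dim_row B" "dim_col (kron A B) = dim_col A * dim_col B"
  by (simp_all add: kron_def)

lemma dsum_carrier:
  assumes "\<And>i. i < n \<Longrightarrow> A i \<in> carrier_mat (r i) (c i)" "N = (\<Sum>i<n. r i)" "M = (\<Sum>i<n. c i)"
  shows "dsum n A \<in> carrier_mat N M"
proof (rule carrier_matI)
  show "dim_row (dsum n A) = N" "dim_col (dsum n A) = M"
    using assms(1) by (auto simp: assms(2,3) intro!: sum.cong)
qed

lemma kron_carrier:
  assumes "A \<in> carrier_mat r c" "B \<in> carrier_mat r' c'" "N = r * r'" "M = c * c'"
  shows "kron A B \<in> carrier_mat N M"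
  using assms by (intro carrier_matI) auto

text \<open>For products of block diagonal matrices: the zero blocks leave only the fibre over the
  block of the given row.\<close>

lemma sum_Sigma_single:
  assumes "finite A" "\<And>x. x \<in> A \<Longrightarrow> finite (B x)" "a \<in> A"
    and "\<And>x y. x \<in> A \<Longrightarrow> y \<in> B x \<Longrightarrow> x \<noteq> a \<Longrightarrow> f (x, y) = 0"
  shows "sum f (Sigma A B) = (\<Sum>y\<in>B a. f (a, y))"
proof -
  have "sum f (Sigma A B) = (\<Sum>x\<in>A. \<Sum>y\<in>B x. f (x, y))"
    using assms by (subst sum.Sigma) (auto simp: case_prod_unfold)
  also have "\<dots> = (\<Sum>x\<in>A. if x = a then \<Sum>y\<in>B x. f (x, y) else 0)"
    using assms by (intro sum.cong) auto
  finally show ?thesis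
    using assms by simp
qed

lemma dsum_mult:
  fixes A B :: "nat \<Rightarrow> 'a::semiring_0 mat"
  assumes "\<And>i. i < n \<Longrightarrow> A i \<in> carrier_mat (r i) (c i)" "\<And>i. i < n \<Longrightarrow> B i \<in> carrier_mat (c i) (d i)"
  shows "dsum n A * dsum n B = dsum n (\<lambda>i. A i * B i)"
proof -
  have "dsum n A * dsum n B
    = dsum n (\<lambda>i. lab_mat [0..<r i] [0..<c i] (\<lambda>p q. A i $$ (p, q)))
      * dsum n (\<lambda>i. lab_mat [0..<c i] [0..<d i] (\<lambda>p q. B i $$ (p, q)))"
    using mat_eq_lab_mat[OF assms(1)] mat_eq_lab_mat[OF assms(2)]
    by (intro arg_cong2[where f="(*)"] dsum_cong) auto
  also have "\<dots> = dsum n (\<lambda>i. lab_mat [0..<r i] [0..<c i] (\<lambda>p q. A i $$ (p, q))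
      * lab_mat [0..<c i] [0..<d i] (\<lambda>p q. B i $$ (p, q)))"
    apply (simp only: dsum_lab_mat lab_mat_mult distinct_upt distinct_dep_prod)
    apply (rule lab_mat_cong[OF refl refl])
    \<comment> \<open>The row label \<open>x\<close> lies in block \<open>fst x\<close>, and every
      summand from another block vanishes.\<close>
    subgoal for x z
      unfolding set_dep_prod
      by (subst sum_Sigma_single[where a="fst x"]) (auto intro!: sum.cong)
    done
  also have "\<dots> = dsum n (\<lambda>i. A i * B i)"
    using mat_eq_lab_mat[OF assms(1)] mat_eq_lab_mat[OF assms(2)]
    by (intro dsum_cong) auto
  finally show ?thesis .
qed

text \<open>The mixed product property: the sum over pairs of labels factors once the entries of
  \<open>C\<close> are moved past those of \<open>B\<close>, which uses commutativity.\<close>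

lemma kron_mult:
  fixes A B C D :: "'a::comm_semiring_0 mat"
  assumes "A \<in> carrier_mat r n" "B \<in> carrier_mat n c" "C \<in> carrier_mat r' n'" "D \<in> carrier_mat n' c'"
  shows "kron A C * kron B D = kron (A * B) (C * D)"
proof -
  note eqs = mat_eq_lab_mat[OF assms(1)] mat_eq_lab_mat[OF assms(2)]
    mat_eq_lab_mat[OF assms(3)] mat_eq_lab_mat[OF assms(4)]
  show ?thesis
    \<comment> \<open>Each equation has its matrix on both sides, so exactly the two original
      occurrences are replaced.\<close>
    apply (subst (1 2) eqs(1), subst (1 2) eqs(2), subst (1 2) eqs(3), subst (1 2) eqs(4))
    apply (simp only: kron_lab_mat lab_mat_mult distinct_upt distinct_dep_prod)
    apply (rule lab_mat_cong)
    apply (auto simp: sum_product sum.cartesian_product intro!: sum.cong simp: algebra_simps)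
    done
qed

lemma kron_one: "kron (1\<^sub>m a) (1\<^sub>m b) = (1\<^sub>m (a * b) :: 'a::semiring_1 mat)"
proof -
  \<comment> \<open>Sizes are written as lengths of lists so that the identity matrices become
    labelled ones.\<close>
  have "kron (1\<^sub>m a) (1\<^sub>m b) = (kron (1\<^sub>m (length [0..<a])) (1\<^sub>m (length [0..<b])) :: 'a mat)"
    by simp
  also have "\<dots> = 1\<^sub>m (length (dep_prod [0..<a] (\<lambda>_. [0..<b])))"
    apply (simp only: one_mat_eq_lab_mat distinct_upt distinct_dep_prod kron_lab_mat)
    apply (rule lab_mat_cong)
    apply (auto split: if_splits)
    done
  finally show ?thesis by simp
qed

lemma dsum_one: "dsum n (\<lambda>i. 1\<^sub>m (a i)) = (1\<^sub>m (\<Sum>i<n. a i) :: 'a::{zero,one} mat)"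
proof -
  have "dsum n (\<lambda>i. 1\<^sub>m (a i)) = (dsum n (\<lambda>i. 1\<^sub>m (length [0..<a i])) :: 'a mat)"
    by simp
  also have "\<dots> = 1\<^sub>m (length (dep_prod [0..<n] (\<lambda>i. [0..<a i])))"
    apply (simp only: one_mat_eq_lab_mat distinct_upt distinct_dep_prod dsum_lab_mat)
    apply (rule lab_mat_cong)
    apply (auto split: if_splits)
    done
  finally show ?thesis by simp
qed

lemma dsum_kron_mult:
  fixes A B C D :: "nat \<Rightarrow> 'a::comm_semiring_0 mat"
  assumes "\<And>i. i < n \<Longrightarrow> A i \<in> carrier_mat (b i) (c i)" "\<And>i. i < n \<Longrightarrow> B i \<in> carrier_mat (c i) (d i)"
    and "\<And>i. i < n \<Longrightarrow> C i \<in> carrier_mat (b' i) (c' i)" "\<And>i. i < n \<Longrightarrow> D i \<in> carrier_mat (c' i) (d' i)"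
  shows "dsum n (\<lambda>i. kron (A i) (C i)) * dsum n (\<lambda>i. kron (B i) (D i))
    = dsum n (\<lambda>i. kron (A i * B i) (C i * D i))"
proof -
  have "dsum n (\<lambda>i. kron (A i) (C i)) * dsum n (\<lambda>i. kron (B i) (D i))
    = dsum n (\<lambda>i. kron (A i) (C i) * kron (B i) (D i))"
    by (rule dsum_mult[OF kron_carrier[OF assms(1,3) refl refl] kron_carrier[OF assms(2,4) refl refl]])
  also have "\<dots> = dsum n (\<lambda>i. kron (A i * B i) (C i * D i))"
    by (intro dsum_cong refl kron_mult[OF assms])
  finally show ?thesis .
qed

lemma dsum_one_kron_mult:
  fixes A B :: "nat \<Rightarrow> 'a::comm_semiring_1 mat"
  assumes "\<And>i. i < n \<Longrightarrow> A i \<in> carrier_mat (b i) (c i)" "\<And>i. i < n \<Longrightarrow> B i \<in> carrier_mat (c i) (d i)"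
  shows "dsum n (\<lambda>i. kron (1\<^sub>m (r i)) (A i * B i))
    = dsum n (\<lambda>i. kron (1\<^sub>m (r i)) (A i)) * dsum n (\<lambda>i. kron (1\<^sub>m (r i)) (B i))"
proof -
  have "dsum n (\<lambda>i. kron (1\<^sub>m (r i)) (A i)) * dsum n (\<lambda>i. kron (1\<^sub>m (r i)) (B i))
    = dsum n (\<lambda>i. kron (1\<^sub>m (r i) * 1\<^sub>m (r i)) (A i * B i))"
    by (rule dsum_kron_mult[OF one_carrier_mat one_carrier_mat assms])
  then show ?thesis
    by simp
qed

lemma dsum_kron_one_mult:
  fixes A B :: "nat \<Rightarrow> 'a::comm_semiring_1 mat"
  assumes "\<And>i. i < n \<Longrightarrow> A i \<in> carrier_mat (b i) (c i)" "\<And>i. i < n \<Longrightarrow> B i \<in> carrier_mat (c i) (d i)"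
  shows "dsum n (\<lambda>i. kron (A i * B i) (1\<^sub>m (r i)))
    = dsum n (\<lambda>i. kron (A i) (1\<^sub>m (r i))) * dsum n (\<lambda>i. kron (B i) (1\<^sub>m (r i)))"
proof -
  have "dsum n (\<lambda>i. kron (A i) (1\<^sub>m (r i))) * dsum n (\<lambda>i. kron (B i) (1\<^sub>m (r i)))
    = dsum n (\<lambda>i. kron (A i * B i) (1\<^sub>m (r i) * 1\<^sub>m (r i)))"
    by (rule dsum_kron_mult[OF assms one_carrier_mat one_carrier_mat])
  then show ?thesis
    by simp
qed

text \<open>Pulls the gauge factors of an inner horizontal composite out of the direct sum, here for
  \<gamma>, \<beta> composed first; \<open>dsum_kron_sandwich_right\<close> serves the other
  bracketing. As \<open>M i\<close> may be rectangular, its row size appears on one side and its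
  column size on the other.\<close>

lemma dsum_kron_sandwich_left:
  fixes A B C M :: "nat \<Rightarrow> 'a::comm_semiring_1 mat"
  assumes A: "\<And>i. i < n \<Longrightarrow> A i \<in> carrier_mat (x i) (y i)" and B: "\<And>i. i < n \<Longrightarrow> B i \<in> carrier_mat (y i) (z i)"
    and C: "\<And>i. i < n \<Longrightarrow> C i \<in> carrier_mat (z i) (u i)" and M: "\<And>i. i < n \<Longrightarrow> M i \<in> carrier_mat (r i) (c i)"
  shows "dsum n (\<lambda>i. kron (A i * B i * C i) (M i))
    = dsum n (\<lambda>i. kron (A i) (1\<^sub>m (r i))) * dsum n (\<lambda>i. kron (B i) (M i)) * dsum n (\<lambda>i. kron (C i) (1\<^sub>m (c i)))"
proof -
  have "dsum n (\<lambda>i. kron (A i) (1\<^sub>m (r i))) * dsum n (\<lambda>i. kron (B i) (M i))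
      = dsum n (\<lambda>i. kron (A i * B i) (1\<^sub>m (r i) * M i))"
    by (rule dsum_kron_mult[OF A B one_carrier_mat M])
  also have "\<dots> = dsum n (\<lambda>i. kron (A i * B i) (M i))"
    by (intro dsum_cong) (simp_all add: left_mult_one_mat[OF M] right_mult_one_mat[OF M])
  also have "\<dots> * dsum n (\<lambda>i. kron (C i) (1\<^sub>m (c i))) = dsum n (\<lambda>i. kron (A i * B i * C i) (M i * 1\<^sub>m (c i)))"
    by (rule dsum_kron_mult[OF mult_carrier_mat[OF A B] C M one_carrier_mat])
  also have "\<dots> = dsum n (\<lambda>i. kron (A i * B i * C i) (M i))"
    by (intro dsum_cong) (simp_all add: left_mult_one_mat[OF M] right_mult_one_mat[OF M])
  finally show ?thesis ..
qed

lemma dsum_kron_sandwich_right: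
  fixes A B C M :: "nat \<Rightarrow> 'a::comm_semiring_1 mat"
  assumes A: "\<And>i. i < n \<Longrightarrow> A i \<in> carrier_mat (x i) (y i)" and B: "\<And>i. i < n \<Longrightarrow> B i \<in> carrier_mat (y i) (z i)"
    and C: "\<And>i. i < n \<Longrightarrow> C i \<in> carrier_mat (z i) (u i)" and M: "\<And>i. i < n \<Longrightarrow> M i \<in> carrier_mat (r i) (c i)"
  shows "dsum n (\<lambda>i. kron (M i) (A i * B i * C i))
    = dsum n (\<lambda>i. kron (1\<^sub>m (r i)) (A i)) * dsum n (\<lambda>i. kron (M i) (B i)) * dsum n (\<lambda>i. kron (1\<^sub>m (c i)) (C i))"
proof -
  have "dsum n (\<lambda>i. kron (1\<^sub>m (r i)) (A i)) * dsum n (\<lambda>i. kron (M i) (B i))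
      = dsum n (\<lambda>i. kron (1\<^sub>m (r i) * M i) (A i * B i))"
    by (rule dsum_kron_mult[OF one_carrier_mat M A B])
  also have "\<dots> = dsum n (\<lambda>i. kron (M i) (A i * B i))"
    by (intro dsum_cong) (simp_all add: left_mult_one_mat[OF M] right_mult_one_mat[OF M])
  also have "\<dots> * dsum n (\<lambda>i. kron (1\<^sub>m (c i)) (C i)) = dsum n (\<lambda>i. kron (M i * 1\<^sub>m (c i)) (A i * B i * C i))"
    by (rule dsum_kron_mult[OF M one_carrier_mat mult_carrier_mat[OF A B] C])
  also have "\<dots> = dsum n (\<lambda>i. kron (M i) (A i * B i * C i))"
    by (intro dsum_cong) (simp_all add: left_mult_one_mat[OF M] right_mult_one_mat[OF M])
  finally show ?thesis ..
qed

text \<open>A block of size 0 x 0 contributes neither rows nor columns. A block with one positive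
  side would still add zero rows or columns, so both sizes must vanish.\<close>

lemma dsum_single:
  assumes "k < n" "\<And>i. i < n \<Longrightarrow> i \<noteq> k \<Longrightarrow> A i \<in> carrier_mat 0 0"
  shows "dsum n A = A k"
proof -
  let ?L = "\<lambda>i. [0..<dim_row (A i)]" and ?K = "\<lambda>i. [0..<dim_col (A i)]"
  have "A i = lab_mat (?L i) (?K i) (\<lambda>p q. A i $$ (p, q))" for i
    by (rule mat_eq_lab_mat) simp
  then have "dsum n A = dsum n (\<lambda>i. lab_mat (?L i) (?K i) (\<lambda>p q. A i $$ (p, q)))"
    by (intro dsum_cong refl)
  also have "\<dots> = lab_mat (map (Pair k) (?L k)) (map (Pair k) (?K k))
      (\<lambda>(i, x) (i', y). if i = i' then A i $$ (x, y) else 0)"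
    unfolding dsum_lab_mat using assms
    by (intro lab_mat_cong refl dep_prod_single) auto
  also have "\<dots> = lab_mat (?L k) (?K k) (\<lambda>p q. A k $$ (p, q))"
    by (simp add: lab_mat_map)
  also have "\<dots> = A k"
    by (rule mat_eq_lab_mat[symmetric]) simp
  finally show ?thesis .
qed

lemma kron_one_one [simp]:
  fixes A :: "'a::semiring_1 mat"
  shows "kron A (1\<^sub>m (Suc 0)) = A" "kron (1\<^sub>m (Suc 0)) A = A"
  by (auto simp: kron_def intro!: eq_matI)

section \<open>The permutation matrices\<close>

text \<open>The linear map taking the basis vector labelled \<open>y\<close> to the one labelled
  \<open>\<phi> y\<close>; composition of maps becomes the matrix product.\<close>

definition rel_mat :: "'i list \<Rightarrow> 'j list \<Rightarrow> ('j \<Rightarrow> 'i) \<Rightarrow> complex mat" where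
  "rel_mat L K \<phi> = lab_mat L K (\<lambda>x y. if x = \<phi> y then 1 else 0)"

text \<open>Each row of the 0/1 matrix has a single nonzero entry, so multiplication from the left
  relabels rows by the inverse \<open>\<psi>\<close> of \<open>\<phi>\<close>. Multiplication from
  the right relabels columns by \<open>\<phi>\<close> itself.\<close>

lemma rel_mat_mult_lab_mat:
  assumes "distinct K" "\<And>x. x \<in> set L \<Longrightarrow> \<psi> x \<in> set K"
    "\<And>x y. x \<in> set L \<Longrightarrow> y \<in> set K \<Longrightarrow> x = \<phi> y \<longleftrightarrow> y = \<psi> x"
  shows "rel_mat L K \<phi> * lab_mat K M F = lab_mat L M (\<lambda>x z. F (\<psi> x) z)"
  unfolding rel_mat_def lab_mat_mult[OF assms(1)]
proof (rule lab_mat_cong[OF refl refl])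
  fix x z assume x: "x \<in> set L"
  have "(\<Sum>y\<in>set K. (if x = \<phi> y then 1 else 0) * F y z) = (\<Sum>y\<in>set K. if y = \<psi> x then F y z else 0)"
    using assms(3)[OF x] by (intro sum.cong) auto
  then show "(\<Sum>y\<in>set K. (if x = \<phi> y then 1 else 0) * F y z) = F (\<psi> x) z"
    using assms(2)[OF x] by simp
qed

lemma lab_mat_mult_rel_mat:
  assumes "distinct K" "\<And>z. z \<in> set M \<Longrightarrow> \<phi> z \<in> set K"
  shows "lab_mat L K F * rel_mat K M \<phi> = lab_mat L M (\<lambda>x z. F x (\<phi> z))"
  unfolding rel_mat_def lab_mat_mult[OF assms(1)]
proof (rule lab_mat_cong[OF refl refl])
  fix x z assume z: "z \<in> set M"
  have "(\<Sum>y\<in>set K. F x y * (if y = \<phi> z then 1 else 0)) = (\<Sum>y\<in>set K. if y = \<phi> z then F x y else 0)"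
    by (intro sum.cong) auto
  then show "(\<Sum>y\<in>set K. F x y * (if y = \<phi> z then 1 else 0)) = F x (\<phi> z)"
    using assms(2)[OF z] by simp
qed

lemma rel_mat_mult:
  assumes "distinct K" "\<And>z. z \<in> set M \<Longrightarrow> \<psi> z \<in> set K"
  shows "rel_mat L K \<phi> * rel_mat K M \<psi> = rel_mat L M (\<lambda>z. \<phi> (\<psi> z))"
  using lab_mat_mult_rel_mat[OF assms] by (simp add: rel_mat_def)

lemma rel_mat_cong:
  assumes "L = L'" "K = K'" "\<And>y. y \<in> set K' \<Longrightarrow> \<phi> y = \<psi> y"
  shows "rel_mat L K \<phi> = rel_mat L' K' \<psi>"
  unfolding rel_mat_def using assms by (intro lab_mat_cong) auto

text \<open>If \<open>\<phi>\<close> carries \<open>K\<close> to \<open>L\<close> in order, equal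
  labels sit at equal positions. Triviality of a permutation matrix always comes down to
  this.\<close>

lemma rel_mat_eq_one:
  assumes "distinct L" "L = map \<phi> K"
  shows "rel_mat L K \<phi> = 1\<^sub>m (length L)"
proof -
  have "rel_mat L K \<phi> = lab_mat (map id L) (map \<phi> K) (\<lambda>x y. if x = y then 1 else 0)"
    by (simp only: lab_mat_map rel_mat_def id_apply)
  then show ?thesis
    by (simp only: assms(2)[symmetric] one_mat_eq_lab_mat[OF assms(1)] list.map_id)
qed

lemma dsum_rel_mat:
  "dsum n (\<lambda>i. rel_mat (L i) (K i) (\<phi> i))
   = rel_mat (dep_prod [0..<n] L) (dep_prod [0..<n] K) (\<lambda>(i, x). (i, \<phi> i x))"
  unfolding rel_mat_def dsum_lab_mat by (rule lab_mat_cong) (auto split: if_splits)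

text \<open>\<open>U\<close> is any labelling of the \<open>r\<close> copies; only its length enters
  the matrix on the left.\<close>

lemma kron_one_rel_mat:
  assumes "distinct U" "length U = r"
  shows "kron (1\<^sub>m r) (rel_mat L K \<phi>)
   = rel_mat (dep_prod U (\<lambda>_. L)) (dep_prod U (\<lambda>_. K)) (\<lambda>(i, x). (i, \<phi> x))"
  unfolding assms(2)[symmetric] one_mat_eq_lab_mat[OF assms(1)] rel_mat_def kron_lab_mat
  by (rule lab_mat_cong) (auto split: if_splits)

lemma kron_rel_mat_one:
  assumes "distinct U" "length U = r"
  shows "kron (rel_mat L K \<phi>) (1\<^sub>m r)
   = rel_mat (dep_prod L (\<lambda>_. U)) (dep_prod K (\<lambda>_. U)) (\<lambda>(x, i). (\<phi> x, i))"
  unfolding assms(2)[symmetric] one_mat_eq_lab_mat[OF assms(1)] rel_mat_def kron_lab_mat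
  by (rule lab_mat_cong) (auto split: if_splits)

text \<open>
  The lists \<open>U\<close>, \<open>V\<close>, \<open>X\<close> of labels are arbitrary rather than initial segments: the coherence law
  uses tuples as labels, so that both of its sides are indexed by the same nested tuples.
\<close>

definition distr_src ::
  "nat \<Rightarrow> nat \<Rightarrow> (nat \<Rightarrow> 'u list) \<Rightarrow> (nat \<Rightarrow> nat \<Rightarrow> 'v list) \<Rightarrow> (nat \<Rightarrow> 'x list)
    \<Rightarrow> (nat \<times> (nat \<times> 'u \<times> 'v) \<times> 'x) list" where
  "distr_src m n U V X =
     dep_prod [0..<n] (\<lambda>j. dep_prod (dep_prod [0..<m] (\<lambda>i. dep_prod (U i) (\<lambda>_. V i j))) (\<lambda>_. X j))"

definition distr_tgt ::
  "nat \<Rightarrow> nat \<Rightarrow> (nat \<Rightarrow> 'u list) \<Rightarrow> (nat \<Rightarrow> nat \<Rightarrow> 'v list) \<Rightarrow> (nat \<Rightarrow> 'x list)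
    \<Rightarrow> (nat \<times> 'u \<times> nat \<times> 'v \<times> 'x) list" where
  "distr_tgt m n U V X =
     dep_prod [0..<m] (\<lambda>i. dep_prod (U i) (\<lambda>_. dep_prod [0..<n] (\<lambda>j. dep_prod (V i j) (\<lambda>_. X j))))"

fun distr :: "nat \<times> (nat \<times> 'u \<times> 'v) \<times> 'x \<Rightarrow> nat \<times> 'u \<times> nat \<times> 'v \<times> 'x" where
  "distr (j, (i, u, v), x) = (i, u, j, v, x)"

fun undistr :: "nat \<times> 'u \<times> nat \<times> 'v \<times> 'x \<Rightarrow> nat \<times> (nat \<times> 'u \<times> 'v) \<times> 'x" where
  "undistr (i, u, j, v, x) = (j, (i, u, v), x)"

text \<open>Changes labels and keeps positions.\<close>

lemma dep_prod_relabel: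
  assumes "L = map f L'" "\<And>x. x \<in> set L' \<Longrightarrow> K (f x) = map (g x) (K' x)"
  shows "dep_prod L K = map (\<lambda>(x, y). (f x, g x y)) (dep_prod L' K')"
  using assms(2) unfolding assms(1) by (induction L') auto

section \<open>The permutation matrix as the labelled matrix of \<open>distr\<close>\<close>

lemma perm_tgt_eq:
  assumes "r \<in> carrier_vec m" "R \<in> carrier_mat m n" "a \<in> carrier_vec n"
  shows "perm_tgt r R a
   = distr_tgt m n (\<lambda>i. [0..<r $ i]) (\<lambda>i j. [0..<R $$ (i, j)]) (\<lambda>j. [0..<a $ j])"
  using assms
  by (simp add: perm_tgt_def distr_tgt_def dep_prod_def map_concat comp_def)

lemma perm_copies_eq:
  assumes "R \<in> carrier_mat m n"
  shows "perm_copies r R j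
   = dep_prod [0..<m] (\<lambda>i. dep_prod [0..<r $ i] (\<lambda>_. [0..<R $$ (i, j)]))"
  using assms by (simp add: perm_copies_def dep_prod_def map_concat comp_def)

text \<open>The counter \<open>t\<close> is replaced by the \<open>t\<close>-th triple
  \<open>(i, u, v)\<close>. The convention that copies of a block keep their relative order is
  thereby absorbed into the lexicographic order of labels.\<close>

lemma distr_src_eq_perm_src:
  assumes "r \<in> carrier_vec m" "R \<in> carrier_mat m n" "a \<in> carrier_vec n"
  shows "distr_src m n (\<lambda>i. [0..<r $ i]) (\<lambda>i j. [0..<R $$ (i, j)]) (\<lambda>j. [0..<a $ j])
    = map (\<lambda>(j, t, x). (j, perm_copies r R j ! t, x)) (perm_src r R a)"
proof -
  have len: "length (perm_copies r R j) = perm_mult r R j" for j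
    using assms by (simp add: perm_copies_eq perm_mult_def)
  have src: "perm_src r R a
    = dep_prod [0..<n] (\<lambda>j. dep_prod [0..<perm_mult r R j] (\<lambda>_. [0..<a $ j]))"
    using assms by (simp add: perm_src_def dep_prod_def map_concat comp_def)
  show ?thesis
    unfolding distr_src_def perm_copies_eq[OF assms(2), symmetric] src
    apply (subst dep_prod_relabel[where f = "\<lambda>j. j" and
      g = "\<lambda>j (t, x). (perm_copies r R j ! t, x)" and
      K' = "\<lambda>j. dep_prod [0..<perm_mult r R j] (\<lambda>_. [0..<a $ j])" and L' = "[0..<n]"])
      apply simp
     \<comment> \<open>As \<open>t\<close> runs through the positions of the list of copies,
       indexing reproduces that list (\<open>map_nth\<close>).\<close>
     apply (subst dep_prod_relabel[where f = "(!) (perm_copies r R _)" and g = "\<lambda>_ x. x" and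
      L' = "[0..<perm_mult r R _]"])
       apply (simp_all add: map_nth flip: len)
    done
qed

text \<open>Both bracketings have the same total length, which is why the permutation matrix is
  square.\<close>

lemma length_distr:
  assumes "\<And>i. i < m \<Longrightarrow> length (U i) = r i"
    "\<And>i j. i < m \<Longrightarrow> j < n \<Longrightarrow> length (V i j) = R i j"
    "\<And>j. j < n \<Longrightarrow> length (X j) = a j"
  shows "length (distr_tgt m n U V X) = (\<Sum>i<m. r i * (\<Sum>j<n. R i j * a j))"
    and "length (distr_src m n U V X) = (\<Sum>i<m. r i * (\<Sum>j<n. R i j * a j))"
proof -
  show "length (distr_tgt m n U V X) = (\<Sum>i<m. r i * (\<Sum>j<n. R i j * a j))"
    using assms by (simp add: distr_tgt_def)
  have "length (distr_src m n U V X) = (\<Sum>j<n. (\<Sum>i<m. r i * R i j) * a j)"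
    using assms by (simp add: distr_src_def)
  also have "\<dots> = (\<Sum>i<m. r i * (\<Sum>j<n. R i j * a j))"
    by (simp add: sum_distrib_left sum_distrib_right mult.assoc) (rule sum.swap)
  finally show "length (distr_src m n U V X) = (\<Sum>i<m. r i * (\<Sum>j<n. R i j * a j))" .
qed

lemma perm_mat_upt:
  assumes "r \<in> carrier_vec m" "R \<in> carrier_mat m n" "a \<in> carrier_vec n"
  shows "perm_mat r R a
    = rel_mat (distr_tgt m n (\<lambda>i. [0..<r $ i]) (\<lambda>i j. [0..<R $$ (i, j)]) (\<lambda>j. [0..<a $ j]))
        (distr_src m n (\<lambda>i. [0..<r $ i]) (\<lambda>i j. [0..<R $$ (i, j)]) (\<lambda>j. [0..<a $ j])) distr"
    (is "_ = rel_mat ?T ?S _")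
proof -
  have "length ?S = (\<Sum>j<n. perm_mult r R j * a $ j)"
    using assms by (simp add: distr_src_def perm_mult_def)
  then have len: "length (perm_src r R a) = (\<Sum>j<n. perm_mult r R j * a $ j)"
    using assms by (simp add: distr_src_eq_perm_src)
  moreover have "length ?T = length ?S"
    using length_distr[of m "\<lambda>i. [0..<r $ i]" "\<lambda>i. r $ i" n "\<lambda>i j. [0..<R $$ (i, j)]"
        "\<lambda>i j. R $$ (i, j)" "\<lambda>j. [0..<a $ j]" "\<lambda>j. a $ j"] by simp
  ultimately have len': "length ?T = (\<Sum>j<n. perm_mult r R j * a $ j)"
    using assms by (simp add: distr_src_eq_perm_src)
  show ?thesis
    using assms len len'
    by (intro eq_matI)
      (auto simp: perm_mat_def Let_def rel_mat_def perm_tgt_eq distr_src_eq_perm_src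
        split: prod.splits)
qed

text \<open>Relabelling targets by \<open>f\<close> and sources by \<open>g\<close> keeps positions
  and intertwines \<open>distr\<close>; distinctness makes \<open>f\<close> injective, so the 0/1
  entries agree.\<close>

lemma perm_mat_eq_rel_mat:
  assumes "r \<in> carrier_vec m" "R \<in> carrier_mat m n" "a \<in> carrier_vec n"
    and "\<And>i. i < m \<Longrightarrow> distinct (U i) \<and> length (U i) = r $ i"
    and "\<And>i j. i < m \<Longrightarrow> j < n \<Longrightarrow> distinct (V i j) \<and> length (V i j) = R $$ (i, j)"
    and "\<And>j. j < n \<Longrightarrow> distinct (X j) \<and> length (X j) = a $ j"
  shows "perm_mat r R a = rel_mat (distr_tgt m n U V X) (distr_src m n U V X) distr"
proof -
  let ?U = "\<lambda>i. [0..<r $ i]" and ?V = "\<lambda>i j. [0..<R $$ (i, j)]" and ?X = "\<lambda>j. [0..<a $ j]"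
  define f where "f = (\<lambda>(i, u, j, v, x). (i, U i ! u, j, V i j ! v, X j ! x))"
  define g where "g = (\<lambda>(j, (i, u, v), x). (j, (i, U i ! u, V i j ! v), X j ! x))"
  have U: "U i = map ((!) (U i)) (?U i)" if "i < m" for i
    using assms(4)[OF that] by (metis map_nth)
  have V: "V i j = map ((!) (V i j)) (?V i j)" if "i < m" "j < n" for i j
    using assms(5)[OF that] by (metis map_nth)
  have X: "X j = map ((!) (X j)) (?X j)" if "j < n" for j
    using assms(6)[OF that] by (metis map_nth)
  have VX: "dep_prod (V i j) (\<lambda>_. X j) = map (\<lambda>(v, x). (V i j ! v, X j ! x)) (dep_prod (?V i j) (\<lambda>_. ?X j))"
    if "i < m" "j < n" for i j
    by (rule dep_prod_relabel[OF V[OF that] X[OF that(2)]])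
  have VXj: "dep_prod [0..<n] (\<lambda>j. dep_prod (V i j) (\<lambda>_. X j))
      = map (\<lambda>(j, v, x). (j, V i j ! v, X j ! x)) (dep_prod [0..<n] (\<lambda>j. dep_prod (?V i j) (\<lambda>_. ?X j)))"
    if "i < m" for i
    using VX[OF that] by (subst dep_prod_relabel[where f = "\<lambda>j. j"]) auto
  have UVX: "dep_prod (U i) (\<lambda>_. dep_prod [0..<n] (\<lambda>j. dep_prod (V i j) (\<lambda>_. X j)))
      = map (\<lambda>(u, j, v, x). (U i ! u, j, V i j ! v, X j ! x))
          (dep_prod (?U i) (\<lambda>_. dep_prod [0..<n] (\<lambda>j. dep_prod (?V i j) (\<lambda>_. ?X j))))"
    if "i < m" for i
    by (rule trans, rule dep_prod_relabel[OF U[OF that] VXj[OF that]]) auto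
  have tgt: "distr_tgt m n U V X = map f (distr_tgt m n ?U ?V ?X)"
    unfolding distr_tgt_def f_def
    by (rule trans, rule dep_prod_relabel[where f = "\<lambda>i. i"]) (auto simp: UVX)
  have UV: "dep_prod (U i) (\<lambda>_. V i j) = map (\<lambda>(u, v). (U i ! u, V i j ! v)) (dep_prod (?U i) (\<lambda>_. ?V i j))"
    if "i < m" "j < n" for i j
    by (rule dep_prod_relabel[OF U[OF that(1)] V[OF that]])
  have iUV: "dep_prod [0..<m] (\<lambda>i. dep_prod (U i) (\<lambda>_. V i j))
      = map (\<lambda>(i, u, v). (i, U i ! u, V i j ! v)) (dep_prod [0..<m] (\<lambda>i. dep_prod (?U i) (\<lambda>_. ?V i j)))"
    if "j < n" for j
    using UV[OF _ that] by (subst dep_prod_relabel[where f = "\<lambda>i. i"]) auto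
  have UVX': "dep_prod (dep_prod [0..<m] (\<lambda>i. dep_prod (U i) (\<lambda>_. V i j))) (\<lambda>_. X j)
      = map (\<lambda>((i, u, v), x). ((i, U i ! u, V i j ! v), X j ! x))
          (dep_prod (dep_prod [0..<m] (\<lambda>i. dep_prod (?U i) (\<lambda>_. ?V i j))) (\<lambda>_. ?X j))"
    if "j < n" for j
    by (rule trans, rule dep_prod_relabel[OF iUV[OF that] X[OF that]]) auto
  have src: "distr_src m n U V X = map g (distr_src m n ?U ?V ?X)"
    unfolding distr_src_def g_def
    by (rule trans, rule dep_prod_relabel[where f = "\<lambda>j. j"]) (auto simp: UVX')
  show ?thesis
    unfolding perm_mat_upt[OF assms(1-3)] tgt src rel_mat_def lab_mat_map
    using assms(4-6)
    by (intro lab_mat_cong) (auto simp: f_def g_def distr_tgt_def distr_src_def nth_eq_iff_index_eq split: if_splits)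
qed

lemma distinct_distr:
  assumes "\<And>i. i < m \<Longrightarrow> distinct (U i)" "\<And>i j. i < m \<Longrightarrow> j < n \<Longrightarrow> distinct (V i j)"
    "\<And>j. j < n \<Longrightarrow> distinct (X j)"
  shows "distinct (distr_tgt m n U V X)" "distinct (distr_src m n U V X)"
  using assms by (auto simp: distr_tgt_def distr_src_def intro!: distinct_dep_prod)

lemma distr_in_tgt [simp]: "distr z \<in> set (distr_tgt m n U V X) \<longleftrightarrow> z \<in> set (distr_src m n U V X)"
  by (cases z rule: distr.cases) (auto simp: distr_tgt_def distr_src_def)

lemma undistr_in_src [simp]: "undistr z \<in> set (distr_src m n U V X) \<longleftrightarrow> z \<in> set (distr_tgt m n U V X)"
  by (cases z rule: undistr.cases) (auto simp: distr_tgt_def distr_src_def)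

lemma eq_distr_iff: "x = distr y \<longleftrightarrow> y = undistr x"
  by (cases x rule: undistr.cases, cases y rule: distr.cases) auto

lemma perm_mat_carrier:
  assumes "r \<in> carrier_vec m" "R \<in> carrier_mat m n" "a \<in> carrier_vec n"
    and "N = (\<Sum>i<m. r $ i * (\<Sum>j<n. R $$ (i, j) * a $ j))"
  shows "perm_mat r R a \<in> carrier_mat N N"
  unfolding perm_mat_upt[OF assms(1-3)] rel_mat_def assms(4)
  by (intro carrier_matI) (simp_all add: length_distr[where r = "\<lambda>i. r $ i" and R = "\<lambda>i j. R $$ (i, j)" and a = "\<lambda>j. a $ j"])

text \<open>Both block matrices have the entries \<open>X i u u' * Y i j v v' * M j x x'\<close>
  where \<open>i\<close> and \<open>j\<close> agree, and zeros elsewhere; only the bracketing of the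
  labels differs (\<open>?F\<close> and \<open>?G\<close>). One permutation relabels the rows, the
  other the columns. They have different sizes when \<open>X\<close>, \<open>Y\<close>,
  \<open>M\<close> are rectangular.\<close>

lemma perm_mat_natural:
  assumes r: "r \<in> carrier_vec m" "R \<in> carrier_mat m n" "a \<in> carrier_vec n"
    and r': "r' \<in> carrier_vec m" "R' \<in> carrier_mat m n" "a' \<in> carrier_vec n"
    and X: "\<And>i. i < m \<Longrightarrow> X i \<in> carrier_mat (r' $ i) (r $ i)"
    and Y: "\<And>i j. i < m \<Longrightarrow> j < n \<Longrightarrow> Y i j \<in> carrier_mat (R' $$ (i, j)) (R $$ (i, j))"
    and M: "\<And>j. j < n \<Longrightarrow> M j \<in> carrier_mat (a' $ j) (a $ j)"
  shows "perm_mat r' R' a' * dsum n (\<lambda>j. kron (dsum m (\<lambda>i. kron (X i) (Y i j))) (M j))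
    = dsum m (\<lambda>i. kron (X i) (dsum n (\<lambda>j. kron (Y i j) (M j)))) * perm_mat r R a"
proof -
  let ?x = "\<lambda>i. lab_mat [0..<r' $ i] [0..<r $ i] (\<lambda>p q. X i $$ (p, q))"
  let ?y = "\<lambda>i j. lab_mat [0..<R' $$ (i, j)] [0..<R $$ (i, j)] (\<lambda>p q. Y i j $$ (p, q))"
  let ?m = "\<lambda>j. lab_mat [0..<a' $ j] [0..<a $ j] (\<lambda>p q. M j $$ (p, q))"
  let ?L = "\<lambda>r R a. distr_tgt m n (\<lambda>i. [0..<r $ i]) (\<lambda>i j. [0..<R $$ (i, j)]) (\<lambda>j. [0..<a $ j])"
  let ?K = "\<lambda>r R a. distr_src m n (\<lambda>i. [0..<r $ i]) (\<lambda>i j. [0..<R $$ (i, j)]) (\<lambda>j. [0..<a $ j])"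
  let ?F = "\<lambda>(j, (i, u, v), x) (j', (i', u', v'), x').
    if j = j' \<and> i = i' then X i $$ (u, u') * Y i j $$ (v, v') * M j $$ (x, x') else 0"
  let ?G = "\<lambda>(i, u, j, v, x) (i', u', j', v', x').
    if j = j' \<and> i = i' then X i $$ (u, u') * Y i j $$ (v, v') * M j $$ (x, x') else 0"
  have "dsum n (\<lambda>j. kron (dsum m (\<lambda>i. kron (X i) (Y i j))) (M j))
    = dsum n (\<lambda>j. kron (dsum m (\<lambda>i. kron (?x i) (?y i j))) (?m j))"
    by (intro dsum_cong arg_cong2[where f = kron] refl mat_eq_lab_mat X Y M)
  also have "\<dots> = lab_mat (?K r' R' a') (?K r R a) ?F"
    unfolding dsum_lab_mat kron_lab_mat distr_src_def
    by (rule lab_mat_cong) (auto split: if_splits)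
  finally have 1: "dsum n (\<lambda>j. kron (dsum m (\<lambda>i. kron (X i) (Y i j))) (M j)) = \<dots>" .
  have "dsum m (\<lambda>i. kron (X i) (dsum n (\<lambda>j. kron (Y i j) (M j))))
    = dsum m (\<lambda>i. kron (?x i) (dsum n (\<lambda>j. kron (?y i j) (?m j))))"
    by (intro dsum_cong arg_cong2[where f = kron] refl mat_eq_lab_mat X Y M)
  also have "\<dots> = lab_mat (?L r' R' a') (?L r R a) ?G"
    unfolding dsum_lab_mat kron_lab_mat distr_tgt_def
    by (rule lab_mat_cong) (auto split: if_splits)
  finally have 2: "dsum m (\<lambda>i. kron (X i) (dsum n (\<lambda>j. kron (Y i j) (M j)))) = \<dots>" .
  have "rel_mat (?L r' R' a') (?K r' R' a') distr * lab_mat (?K r' R' a') (?K r R a) ?F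
    = lab_mat (?L r' R' a') (?K r R a) (\<lambda>x z. ?F (undistr x) z)"
    by (rule rel_mat_mult_lab_mat) (simp_all add: distinct_distr eq_distr_iff)
  also have "\<dots> = lab_mat (?L r' R' a') (?K r R a) (\<lambda>x z. ?G x (distr z))"
  proof (rule lab_mat_cong[OF refl refl])
    show "?F (undistr x) z = ?G x (distr z)" for x z
      by (cases x rule: undistr.cases, cases z rule: distr.cases) simp
  qed
  also have "\<dots> = lab_mat (?L r' R' a') (?L r R a) ?G * rel_mat (?L r R a) (?K r R a) distr"
    by (rule lab_mat_mult_rel_mat[symmetric]) (simp_all add: distinct_distr)
  finally show ?thesis
    unfolding 1 2 perm_mat_upt[OF r] perm_mat_upt[OF r'] .
qed

section \<open>Trivial permutations: unit vectors and identity matrices\<close>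

lemma dep_prod_singleton: "dep_prod L (\<lambda>x. [f x]) = map (\<lambda>x. (x, f x)) L"
  by (induction L) auto

lemma perm_mat_eq_one:
  assumes "r \<in> carrier_vec m" "R \<in> carrier_mat m n" "a \<in> carrier_vec n"
    and "distr_tgt m n (\<lambda>i. [0..<r $ i]) (\<lambda>i j. [0..<R $$ (i, j)]) (\<lambda>j. [0..<a $ j])
      = map distr (distr_src m n (\<lambda>i. [0..<r $ i]) (\<lambda>i j. [0..<R $$ (i, j)]) (\<lambda>j. [0..<a $ j]))"
  shows "perm_mat r R a = 1\<^sub>m (\<Sum>i<m. r $ i * (\<Sum>j<n. R $$ (i, j) * a $ j))"
proof -
  have "length (distr_tgt m n (\<lambda>i. [0..<r $ i]) (\<lambda>i j. [0..<R $$ (i, j)]) (\<lambda>j. [0..<a $ j]))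
      = (\<Sum>i<m. r $ i * (\<Sum>j<n. R $$ (i, j) * a $ j))"
    by (rule length_distr) simp_all
  then show ?thesis
    unfolding perm_mat_upt[OF assms(1-3)] by (simp add: rel_mat_eq_one[OF _ assms(4)] distinct_distr)
qed

text \<open>Only the index \<open>j\<close> and \<open>x = 0\<close> survive, so both lists run
  through \<open>(i, u, v)\<close> lexicographically. Needed for the normalisation of a composite
  gauge.\<close>

lemma perm_mat_unit_col:
  assumes "r \<in> carrier_vec m" "R \<in> carrier_mat m n" "j < n"
    and "N = (\<Sum>i<m. r $ i * R $$ (i, j))"
  shows "perm_mat r R (unit_vec n j) = 1\<^sub>m N"
proof -
  let ?U = "\<lambda>i. [0..<r $ i]" and ?V = "\<lambda>i j. [0..<R $$ (i, j)]" and ?X = "\<lambda>j'. [0..<unit_vec n j $ j']"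
  have X: "?X j' = (if j' = j then [0] else [])" if "j' < n" for j'
    using that assms(3) by (simp add: unit_vec_def)
  have src: "distr_src m n ?U ?V ?X = map (Pair j) (dep_prod (dep_prod [0..<m] (\<lambda>i. dep_prod (?U i) (\<lambda>_. ?V i j))) (\<lambda>_. [0]))"
    unfolding distr_src_def using assms(3) by (subst dep_prod_single[of _ j]) (auto simp: X dep_prod_empty)
  have "distr_tgt m n ?U ?V ?X = dep_prod [0..<m] (\<lambda>i. dep_prod (?U i) (\<lambda>_. map (Pair j) (dep_prod (?V i j) (\<lambda>_. [0]))))"
    unfolding distr_tgt_def using assms(3) by (subst dep_prod_single[of _ j]) (auto simp: X dep_prod_empty)
  with src have "distr_tgt m n ?U ?V ?X = map distr (distr_src m n ?U ?V ?X)"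
    by (simp add: dep_prod_map_snd dep_prod_singleton comp_def case_prod_unfold)
  moreover have "(\<Sum>i<m. r $ i * (\<Sum>j'<n. R $$ (i, j') * unit_vec n j $ j')) = N"
    using assms(3,4) by (simp add: unit_vec_def if_distrib[of "(*) _"] cong: if_cong)
  ultimately show ?thesis
    using perm_mat_eq_one[OF assms(1,2), of "unit_vec n j"] by simp
qed

text \<open>Only \<open>i = k\<close> and \<open>u = 0\<close> survive, so both lists run through
  \<open>(j, v, x)\<close>. Needed for the left unit law.\<close>

lemma perm_mat_unit_row:
  assumes "k < m" "R \<in> carrier_mat m n" "a \<in> carrier_vec n"
    and "N = (\<Sum>j<n. R $$ (k, j) * a $ j)"
  shows "perm_mat (unit_vec m k) R a = 1\<^sub>m N"
proof -
  let ?U = "\<lambda>i. [0..<unit_vec m k $ i]" and ?V = "\<lambda>i j. [0..<R $$ (i, j)]" and ?X = "\<lambda>j. [0..<a $ j]"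
  have U: "?U i = (if i = k then [0] else [])" if "i < m" for i
    using that assms(1) by (simp add: unit_vec_def)
  have "dep_prod [0..<m] (\<lambda>i. dep_prod (?U i) (\<lambda>_. ?V i j)) = map (Pair k) (map (Pair 0) (?V k j))" for j
    using assms(1) by (subst dep_prod_single[of _ k]) (auto simp: U)
  then have "distr_src m n ?U ?V ?X
      = map (\<lambda>(j, v, x). (j, (k, 0, v), x)) (dep_prod [0..<n] (\<lambda>j. dep_prod (?V k j) (\<lambda>_. ?X j)))"
    by (simp add: distr_src_def dep_prod_map dep_prod_map_snd case_prod_unfold)
  moreover have "distr_tgt m n ?U ?V ?X
      = map (Pair k) (map (Pair 0) (dep_prod [0..<n] (\<lambda>j. dep_prod (?V k j) (\<lambda>_. ?X j))))"
    unfolding distr_tgt_def using assms(1) by (subst dep_prod_single[of _ k]) (auto simp: U)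
  ultimately have "distr_tgt m n ?U ?V ?X = map distr (distr_src m n ?U ?V ?X)"
    by (simp add: comp_def case_prod_unfold)
  moreover have "(\<Sum>i<m. unit_vec m k $ i * (\<Sum>j<n. R $$ (i, j) * a $ j)) = N"
    using assms(1,4) by (simp add: unit_vec_def if_distrib[of "\<lambda>x. x * _"] cong: if_cong)
  ultimately show ?thesis
    using perm_mat_eq_one[OF _ assms(2,3), of "unit_vec m k"] by simp
qed

text \<open>Only \<open>i = j\<close> and \<open>v = 0\<close> survive, so both lists run through
  \<open>(j, u, x)\<close>. Needed for the right unit law.\<close>

lemma perm_mat_one:
  assumes "r \<in> carrier_vec n" "a \<in> carrier_vec n" and "N = (\<Sum>j<n. r $ j * a $ j)"
  shows "perm_mat r (1\<^sub>m n) a = 1\<^sub>m N"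
proof -
  let ?U = "\<lambda>i. [0..<r $ i]" and ?V = "\<lambda>i j. [0..<1\<^sub>m n $$ (i, j)]" and ?X = "\<lambda>j. [0..<a $ j]"
  have V: "?V i j = (if i = j then [0] else [])" if "i < n" "j < n" for i j
    using that by simp
  have UV: "dep_prod [0..<n] (\<lambda>i. dep_prod (?U i) (\<lambda>_. ?V i j)) = map (\<lambda>u. (j, u, 0)) (?U j)" if "j < n" for j
    using that by (subst dep_prod_single[of _ j]) (auto simp: V dep_prod_singleton dep_prod_empty)
  have "distr_src n n ?U ?V ?X = dep_prod [0..<n] (\<lambda>j. dep_prod (map (\<lambda>u. (j, u, 0)) (?U j)) (\<lambda>_. ?X j))"
    unfolding distr_src_def by (intro dep_prod_cong refl UV) simp
  then have "distr_src n n ?U ?V ?X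
      = map (\<lambda>(j, u, x). (j, (j, u, 0), x)) (dep_prod [0..<n] (\<lambda>j. dep_prod (?U j) (\<lambda>_. ?X j)))"
    by (simp add: dep_prod_map dep_prod_map_snd case_prod_unfold)
  moreover have VX: "dep_prod [0..<n] (\<lambda>j. dep_prod (?V i j) (\<lambda>_. ?X j)) = map (\<lambda>x. (i, 0, x)) (?X i)" if "i < n" for i
    using that by (subst dep_prod_single[of _ i]) (auto simp: V)
  have "distr_tgt n n ?U ?V ?X = dep_prod [0..<n] (\<lambda>i. dep_prod (?U i) (\<lambda>_. map (\<lambda>x. (i, 0, x)) (?X i)))"
    unfolding distr_tgt_def by (intro dep_prod_cong refl VX) simp
  then have "distr_tgt n n ?U ?V ?X
      = map (\<lambda>(j, u, x). (j, u, j, 0, x)) (dep_prod [0..<n] (\<lambda>j. dep_prod (?U j) (\<lambda>_. ?X j)))"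
    by (simp add: dep_prod_map_snd case_prod_unfold)
  ultimately have "distr_tgt n n ?U ?V ?X = map distr (distr_src n n ?U ?V ?X)"
    by (simp add: comp_def case_prod_unfold)
  moreover have "(\<Sum>i<n. r $ i * (\<Sum>j<n. 1\<^sub>m n $$ (i, j) * a $ j)) = N"
    using assms(3) by (simp add: if_distrib[of "\<lambda>x. x * _"] cong: if_cong)
  ultimately show ?thesis
    using perm_mat_eq_one[OF assms(1) one_carrier_mat assms(2)] by simp
qed

text \<open>Both sides send \<open>(j, (i, (k, u, v), w), x)\<close> to
  \<open>(k, u, i, v, j, w, x)\<close>. The right side passes through
  \<open>(i, (k, u, v), j, w, x)\<close>, the left side through
  \<open>(j, (k, u, i, v, w), x)\<close> and \<open>(k, u, j, (i, v, w), x)\<close>.\<close>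

lemma perm_mat_coherent:
  assumes r: "r \<in> carrier_vec p" and S: "S \<in> carrier_mat p m"
    and R: "R \<in> carrier_mat m n" and a: "a \<in> carrier_vec n"
    and q: "q \<in> carrier_vec m" "\<And>i. i < m \<Longrightarrow> q $ i = (\<Sum>k<p. r $ k * S $$ (k, i))"
  shows "dsum p (\<lambda>k. kron (1\<^sub>m (r $ k)) (perm_mat (row S k) R a)) * perm_mat r (S * R) a
      * dsum n (\<lambda>j. kron (perm_mat r S (R *\<^sub>v unit_vec n j)) (1\<^sub>m (a $ j)))
    = perm_mat r S (R *\<^sub>v a) * perm_mat q R a"
proof -
  let ?U = "\<lambda>k. [0..<r $ k]" and ?V = "\<lambda>k i. [0..<S $$ (k, i)]"
    and ?W = "\<lambda>i j. [0..<R $$ (i, j)]" and ?X = "\<lambda>j. [0..<a $ j]"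
  \<comment> \<open>These lists have as lengths the entry \<open>i\<close> of R(a), the entry
    \<open>i\<close> of \<open>q\<close> and the entry \<open>(k, j)\<close> of
    \<open>S * R\<close>: composite ranks are labelled by tuples.\<close>
  let ?WX = "\<lambda>i. dep_prod [0..<n] (\<lambda>j. dep_prod (?W i j) (\<lambda>_. ?X j))"
    and ?UV = "\<lambda>i. dep_prod [0..<p] (\<lambda>k. dep_prod (?U k) (\<lambda>_. ?V k i))"
    and ?VW = "\<lambda>k j. dep_prod [0..<m] (\<lambda>i. dep_prod (?V k i) (\<lambda>_. ?W i j))"
  have 1: "perm_mat r S (R *\<^sub>v a) = rel_mat (distr_tgt p m ?U ?V ?WX) (distr_src p m ?U ?V ?WX) distr"
    using assms by (intro perm_mat_eq_rel_mat)
      (auto simp: scalar_prod_def atLeast0LessThan intro!: distinct_dep_prod)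
  have 2: "perm_mat q R a = rel_mat (distr_tgt m n ?UV ?W ?X) (distr_src m n ?UV ?W ?X) distr"
    using assms by (intro perm_mat_eq_rel_mat) (auto intro!: distinct_dep_prod)
  have 3: "perm_mat r (S * R) a = rel_mat (distr_tgt p n ?U ?VW ?X) (distr_src p n ?U ?VW ?X) distr"
    using assms by (intro perm_mat_eq_rel_mat)
      (auto simp: scalar_prod_def atLeast0LessThan intro!: distinct_dep_prod)
  have 4: "perm_mat (row S k) R a = rel_mat (distr_tgt m n (?V k) ?W ?X) (distr_src m n (?V k) ?W ?X) distr"
    if "k < p" for k
    using assms that by (intro perm_mat_eq_rel_mat) auto
  have 5: "perm_mat r S (R *\<^sub>v unit_vec n j)
    = rel_mat (distr_tgt p m ?U ?V (\<lambda>i. ?W i j)) (distr_src p m ?U ?V (\<lambda>i. ?W i j)) distr"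
    if "j < n" for j
    using assms that by (intro perm_mat_eq_rel_mat) auto
  let ?A = "distr_tgt p m ?U ?V ?WX" and ?B = "distr_tgt m n ?UV ?W ?X" and ?C = "distr_src m n ?UV ?W ?X"
    and ?E = "distr_tgt p n ?U ?VW ?X" and ?F = "distr_src p n ?U ?VW ?X"
  have 6: "dsum p (\<lambda>k. kron (1\<^sub>m (r $ k)) (perm_mat (row S k) R a))
    = rel_mat ?A ?E (\<lambda>(k, u, z). (k, u, distr z))"
  proof -
    have "dsum p (\<lambda>k. kron (1\<^sub>m (r $ k)) (perm_mat (row S k) R a))
      = dsum p (\<lambda>k. rel_mat (dep_prod (?U k) (\<lambda>_. distr_tgt m n (?V k) ?W ?X))
          (dep_prod (?U k) (\<lambda>_. distr_src m n (?V k) ?W ?X)) (\<lambda>(u, z). (u, distr z)))"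
      by (intro dsum_cong refl) (simp add: 4 kron_one_rel_mat)
    also have "\<dots> = rel_mat ?A ?E (\<lambda>(k, u, z). (k, u, distr z))"
      unfolding dsum_rel_mat by (rule rel_mat_cong) (auto simp: distr_tgt_def distr_src_def)
    finally show ?thesis .
  qed
  \<comment> \<open>The \<open>case\<close> is the identity; it displays
    \<open>(k, u, i, v, w)\<close> as a triple with third component
    \<open>(i, v, w)\<close>.\<close>
  have 7: "dsum n (\<lambda>j. kron (perm_mat r S (R *\<^sub>v unit_vec n j)) (1\<^sub>m (a $ j)))
    = rel_mat ?F ?C (\<lambda>(j, z, x). (j, (case distr z of (k, u, y) \<Rightarrow> (k, u, y)), x))"
  proof -
    have "dsum n (\<lambda>j. kron (perm_mat r S (R *\<^sub>v unit_vec n j)) (1\<^sub>m (a $ j)))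
      = dsum n (\<lambda>j. rel_mat (dep_prod (distr_tgt p m ?U ?V (\<lambda>i. ?W i j)) (\<lambda>_. ?X j))
          (dep_prod (distr_src p m ?U ?V (\<lambda>i. ?W i j)) (\<lambda>_. ?X j)) (\<lambda>(z, x). (distr z, x)))"
      by (intro dsum_cong refl) (simp add: 5 kron_rel_mat_one)
    also have "\<dots> = rel_mat ?F ?C (\<lambda>(j, z, x). (j, (case distr z of (k, u, y) \<Rightarrow> (k, u, y)), x))"
      unfolding dsum_rel_mat by (rule rel_mat_cong) (auto simp: distr_tgt_def distr_src_def)
    finally show ?thesis .
  qed
  \<comment> \<open>\<open>(i, (k, u, v), (j, w, x))\<close> and
    \<open>(i, (k, u, v), j, w, x)\<close> are the same tuple, so the target of one factor is
    literally the source of the next.\<close>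
  have BB: "distr_src p m ?U ?V ?WX = ?B"
    by (simp add: distr_tgt_def distr_src_def)
  have distinct: "distinct ?B" "distinct ?E" "distinct ?F"
    by (auto intro!: distinct_distr distinct_dep_prod)
  show ?thesis
    unfolding 1 2 3 6 7 BB
    apply (subst rel_mat_mult[OF distinct(2)])
     apply simp
    apply (subst rel_mat_mult[OF distinct(3)])
     apply (auto simp: distr_src_def)[]
    apply (subst rel_mat_mult[OF distinct(1)])
     apply simp
    apply (rule rel_mat_cong[OF refl refl])
    apply (auto simp: distr_src_def)
    done
qed

section \<open>Mutually inverse matrices\<close>

text \<open>Carrying an explicit two-sided inverse and the size lets inverses of products, Kronecker
  products and direct sums be written down; \<open>minv\<close> is identified afterwards by
  uniqueness. Size 0 is included.\<close>

definition mutual_inv :: "nat \<Rightarrow> 'a::semiring_1 mat \<Rightarrow> 'a mat \<Rightarrow> bool" where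
  "mutual_inv N A B \<longleftrightarrow>
     A \<in> carrier_mat N N \<and> B \<in> carrier_mat N N \<and> A * B = 1\<^sub>m N \<and> B * A = 1\<^sub>m N"

lemma mutual_invD:
  assumes "mutual_inv N A B"
  shows "A \<in> carrier_mat N N" "B \<in> carrier_mat N N" "A * B = 1\<^sub>m N" "B * A = 1\<^sub>m N"
    "dim_row A = N" "dim_col A = N" "dim_row B = N" "dim_col B = N"
  using assms by (auto simp: mutual_inv_def)

lemma mutual_inv_sym: "mutual_inv N A B \<Longrightarrow> mutual_inv N B A"
  by (simp add: mutual_inv_def)

lemma mutual_inv_one: "mutual_inv N (1\<^sub>m N) (1\<^sub>m N)"
  by (simp add: mutual_inv_def)

lemma mutual_inv_minv:
  fixes A :: "'a::field mat"
  assumes "mutual_inv N A B"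
  shows "minv A = B"
proof -
  note AB = mutual_invD[OF assms]
  \<comment> \<open>The existence of an inverse excludes the answer \<open>None\<close> of
    \<open>mat_inverse\<close>, so \<open>the\<close> yields an actual inverse.\<close>
  have "A \<in> Units (ring_mat TYPE('a) N ())"
    using AB by (auto simp: Units_def ring_mat_def)
  with mat_inverse(1)[OF AB(1), of "()"] obtain C where C: "mat_inverse A = Some C"
    by (cases "mat_inverse A") auto
  note C' = mat_inverse(2)[OF AB(1) C]
  have "B = B * (A * C)"
    using AB C' by simp
  also have "\<dots> = (B * A) * C"
    using AB C' by (intro assoc_mult_mat[symmetric]) auto
  finally show ?thesis
    using AB C C' by (metis left_mult_one_mat option.sel)
qed

lemma minv_one [simp]: "minv (1\<^sub>m N :: 'a::field mat) = 1\<^sub>m N"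
  by (rule mutual_inv_minv[OF mutual_inv_one])

lemma mutual_inv_invertible: "mutual_inv N A B \<Longrightarrow> invertible_mat A"
  by (auto simp: mutual_inv_def invertible_mat_def inverts_mat_def)

lemma invertible_mutual_inv:
  fixes A :: "'a::field mat"
  assumes "A \<in> carrier_mat N N" "invertible_mat A"
  shows "mutual_inv N A (minv A)"
proof -
  from assms obtain B where B: "A * B = 1\<^sub>m N" "B * A = 1\<^sub>m (dim_row B)"
    by (auto simp: invertible_mat_def inverts_mat_def)
  \<comment> \<open>The sizes of \<open>B\<close> are read off by comparing numbers of columns in
    the two equations.\<close>
  have "dim_row B = N" "dim_col B = N"
    using arg_cong[OF B(1), of dim_col] arg_cong[OF B(2), of dim_col] assms by auto
  with assms B have "mutual_inv N A B"
    by (auto simp: mutual_inv_def)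
  then show ?thesis
    by (simp add: mutual_inv_minv)
qed

lemma mutual_inv_mult:
  assumes "mutual_inv N A B" "mutual_inv N C D"
  shows "mutual_inv N (A * C) (D * B)"
proof -
  note AB = mutual_invD[OF assms(1)] and CD = mutual_invD[OF assms(2)]
  have "A * C * (D * B) = A * (C * (D * B))"
    using AB CD by (intro assoc_mult_mat) auto
  also have "\<dots> = A * (C * D * B)"
    using AB CD by (subst assoc_mult_mat[of C N N D N B N]) auto
  finally have 1: "A * C * (D * B) = 1\<^sub>m N"
    using AB CD by simp
  have "D * B * (A * C) = D * (B * (A * C))"
    using AB CD by (intro assoc_mult_mat) auto
  also have "\<dots> = D * (B * A * C)"
    using AB CD by (subst assoc_mult_mat[of B N N A N C N]) auto
  finally have "D * B * (A * C) = 1\<^sub>m N"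
    using AB CD by simp
  with 1 AB CD show ?thesis
    by (auto simp: mutual_inv_def)
qed

lemma mutual_inv_kron:
  fixes A :: "'a::comm_semiring_1 mat"
  assumes "mutual_inv N A B" "mutual_inv M C D" "K = N * M"
  shows "mutual_inv K (kron A C) (kron B D)"
  using assms kron_mult[of A N N B N C M M D M] kron_mult[of B N N A N D M M C M]
  by (auto simp: mutual_inv_def kron_one intro: kron_carrier)

lemma mutual_inv_dsum:
  fixes A :: "nat \<Rightarrow> 'a::semiring_1 mat"
  assumes "\<And>i. i < n \<Longrightarrow> mutual_inv (c i) (A i) (B i)" "N = (\<Sum>i<n. c i)"
  shows "mutual_inv N (dsum n A) (dsum n B)"
proof -
  note AB = mutual_invD[OF assms(1)]
  have "dsum n A * dsum n B = dsum n (\<lambda>i. A i * B i)"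
    using AB by (intro dsum_mult) auto
  also have "\<dots> = dsum n (\<lambda>i. 1\<^sub>m (c i))"
    using AB by (intro dsum_cong) auto
  finally have 1: "dsum n A * dsum n B = 1\<^sub>m N"
    by (simp add: dsum_one assms(2))
  have "dsum n B * dsum n A = dsum n (\<lambda>i. B i * A i)"
    using AB by (intro dsum_mult) auto
  also have "\<dots> = dsum n (\<lambda>i. 1\<^sub>m (c i))"
    using AB by (intro dsum_cong) auto
  finally show ?thesis
    using 1 AB by (auto simp: mutual_inv_def dsum_one assms(2) intro: dsum_carrier)
qed

lemma assoc_mult_mat_dim:
  fixes A B C :: "'a::semiring_0 mat"
  assumes "dim_col A = dim_row B" "dim_col B = dim_row C"
  shows "A * B * C = A * (B * C)"
  using assms by (intro assoc_mult_mat) auto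

text \<open>Stated for right-nested products, the form produced by
  \<open>assoc_mult_mat_dim\<close>, so that it cancels adjacent inverse pairs as a rewrite
  rule.\<close>

lemma mutual_inv_cancel:
  assumes "mutual_inv N A B" "dim_row X = N"
  shows "A * (B * X) = X" "B * (A * X) = X"
proof -
  note AB = mutual_invD[OF assms(1)]
  have "A * (B * X) = A * B * X" "B * (A * X) = B * A * X"
    using AB(5-8) assms(2) by (metis assoc_mult_mat_dim)+
  moreover have "X \<in> carrier_mat N (dim_col X)"
    using assms(2) by auto
  ultimately show "A * (B * X) = X" "B * (A * X) = X"
    using AB(3,4) by simp_all
qed

text \<open>The inverse is the 0/1 matrix of \<open>undistr\<close>.\<close>

lemma perm_mat_mutual_inv:
  assumes "r \<in> carrier_vec m" "R \<in> carrier_mat m n" "a \<in> carrier_vec n"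
    and N: "N = (\<Sum>i<m. r $ i * (\<Sum>j<n. R $$ (i, j) * a $ j))"
  shows "mutual_inv N (perm_mat r R a) (minv (perm_mat r R a))"
proof -
  let ?T = "distr_tgt m n (\<lambda>i. [0..<r $ i]) (\<lambda>i j. [0..<R $$ (i, j)]) (\<lambda>j. [0..<a $ j])"
  let ?S = "distr_src m n (\<lambda>i. [0..<r $ i]) (\<lambda>i j. [0..<R $$ (i, j)]) (\<lambda>j. [0..<a $ j])"
  have len: "length ?T = N" "length ?S = N"
    unfolding N by (rule length_distr; simp)+
  have dis: "distinct ?T" "distinct ?S"
    by (simp_all add: distinct_distr)
  have inv: "distr (undistr x) = x" "undistr (distr y) = y"
    for x :: "nat \<times> nat \<times> nat \<times> nat \<times> nat" and y :: "nat \<times> (nat \<times> nat \<times> nat) \<times> nat"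
    by (metis eq_distr_iff)+
  have "rel_mat ?T ?S distr * rel_mat ?S ?T undistr = 1\<^sub>m N"
    by (subst rel_mat_mult) (simp_all add: dis inv rel_mat_eq_one len)
  moreover have "rel_mat ?S ?T undistr * rel_mat ?T ?S distr = 1\<^sub>m N"
    by (subst rel_mat_mult) (simp_all add: dis inv rel_mat_eq_one len)
  ultimately have "mutual_inv N (perm_mat r R a) (rel_mat ?S ?T undistr)"
    by (simp add: mutual_inv_def perm_mat_upt[OF assms(1-3)] rel_mat_def len carrier_matI)
  then show ?thesis
    by (simp add: mutual_inv_minv)
qed

section \<open>1-morphisms and 2-morphisms\<close>

lemma mult_mat_unit_vec:
  fixes A :: "nat mat"
  assumes "A \<in> carrier_mat m n" "j < n"
  shows "A *\<^sub>v unit_vec n j = col A j"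
  using assms by (intro eq_vecI) auto

lemma index_mult_mat_vec_sum:
  fixes A :: "nat mat"
  assumes "A \<in> carrier_mat m n" "v \<in> carrier_vec n" "i < m"
  shows "(A *\<^sub>v v) $ i = (\<Sum>j<n. A $$ (i, j) * v $ j)"
  using assms by (simp add: scalar_prod_def atLeast0LessThan)

lemma index_mult_mat_sum:
  fixes A :: "nat mat"
  assumes "A \<in> carrier_mat m n" "B \<in> carrier_mat n p" "i < m" "j < p"
  shows "(A * B) $$ (i, j) = (\<Sum>k<n. A $$ (i, k) * B $$ (k, j))"
  using assms by (simp add: scalar_prod_def atLeast0LessThan)

lemma carrier_mat_0_eq: "A \<in> carrier_mat 0 0 \<Longrightarrow> A = 1\<^sub>m 0"
  by (intro eq_matI) auto

text \<open>The only 0 x 0 matrix is the identity and is its own inverse, so rank 0 obeys the same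
  condition as positive rank.\<close>

lemma is_gauge_iff:
  assumes "R \<in> carrier_mat m n"
  shows "is_gauge n m R s \<longleftrightarrow>
    s \<in> carrier_vec n \<rightarrow>\<^sub>E carrier_vec m \<and>
    (\<forall>a\<in>carrier_vec n. \<forall>i<m. mutual_inv ((R *\<^sub>v a) $ i) (s a $ i) (minv (s a $ i))) \<and>
    (\<forall>i<m. \<forall>j<n. s (unit_vec n j) $ i = 1\<^sub>m (R $$ (i, j)))"
proof -
  have *: "(if c \<noteq> 0 then A \<in> carrier_mat c c \<and> invertible_mat A else A = 1\<^sub>m 0)
    \<longleftrightarrow> mutual_inv c A (minv A)" for c and A :: "complex mat"
  proof (cases "c = 0")
    case True
    then show ?thesis
      using mutual_inv_one[of 0, where 'a = complex]
      by (auto dest: mutual_invD(1) carrier_mat_0_eq)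
  next
    case False
    then show ?thesis
      using invertible_mutual_inv mutual_inv_invertible by (auto simp: mutual_invD)
  qed
  \<comment> \<open>For a zero entry of \<open>R\<close> the definition demands no normalisation; it
    holds because the matrix is 0 x 0.\<close>
  have "s (unit_vec n j) $ i = 1\<^sub>m (R $$ (i, j))"
    if "\<forall>a\<in>carrier_vec n. \<forall>i<m. mutual_inv ((R *\<^sub>v a) $ i) (s a $ i) (minv (s a $ i))"
      "i < m" "j < n" "R $$ (i, j) = 0" for i j
  proof -
    have "mutual_inv ((R *\<^sub>v unit_vec n j) $ i) (s (unit_vec n j) $ i) (minv (s (unit_vec n j) $ i))"
      using that by simp
    then have "mutual_inv 0 (s (unit_vec n j) $ i) (minv (s (unit_vec n j) $ i))"
      using that assms by (simp add: mult_mat_unit_vec del: index_mult_mat_vec)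
    with that show ?thesis
      by (auto dest: mutual_invD(1) carrier_mat_0_eq)
  qed
  then show ?thesis
    unfolding is_gauge_def * by blast
qed

text \<open>
  With \<open>0 \<times> 0\<close> matrices invertible, the case distinctions of \<open>is_gauge\<close>, \<open>hom1\<close>, \<open>hom2\<close> and of the
  compositions disappear: over the object \<open>0\<close>, or in rank \<open>0\<close>, the general condition already has the
  zero morphism as its only solution.
\<close>

definition is_mor1 :: "nat \<Rightarrow> nat \<Rightarrow> nat mat \<Rightarrow> gauge \<Rightarrow> bool" where
  "is_mor1 n m R s \<longleftrightarrow> R \<in> carrier_mat m n \<and> is_gauge n m R s"

lemma is_mor1D:
  assumes "is_mor1 n m R s"
  shows "R \<in> carrier_mat m n" "s \<in> carrier_vec n \<rightarrow>\<^sub>E carrier_vec m"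
    "\<And>a i. a \<in> carrier_vec n \<Longrightarrow> i < m \<Longrightarrow> mutual_inv ((R *\<^sub>v a) $ i) (s a $ i) (minv (s a $ i))"
    "\<And>i j. i < m \<Longrightarrow> j < n \<Longrightarrow> s (unit_vec n j) $ i = 1\<^sub>m (R $$ (i, j))"
  using assms is_gauge_iff[of R m n s] by (auto simp: is_mor1_def)

lemma is_mor1I:
  assumes "R \<in> carrier_mat m n" "s \<in> carrier_vec n \<rightarrow>\<^sub>E carrier_vec m"
    "\<And>a i. a \<in> carrier_vec n \<Longrightarrow> i < m \<Longrightarrow> mutual_inv ((R *\<^sub>v a) $ i) (s a $ i) (minv (s a $ i))"
    "\<And>i j. i < m \<Longrightarrow> j < n \<Longrightarrow> s (unit_vec n j) $ i = 1\<^sub>m (R $$ (i, j))"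
  shows "is_mor1 n m R s"
  using assms is_gauge_iff[of R m n s] by (auto simp: is_mor1_def)

lemma trivial_is_mor1:
  assumes "R \<in> carrier_mat m n"
  shows "is_mor1 n m R (trivial_gauge R)"
proof (rule is_mor1I[OF assms])
  fix a :: "nat vec" and i assume "a \<in> carrier_vec n" "i < m"
  then show "mutual_inv ((R *\<^sub>v a) $ i) (trivial_gauge R a $ i) (minv (trivial_gauge R a $ i))"
    using assms by (simp add: trivial_gauge_def mutual_inv_one del: index_mult_mat_vec)
next
  fix i j assume "i < m" "j < n"
  then show "trivial_gauge R (unit_vec n j) $ i = 1\<^sub>m (R $$ (i, j))"
    using assms by (simp add: trivial_gauge_def mult_mat_unit_vec del: index_mult_mat_vec)
qed (use assms in \<open>auto simp: trivial_gauge_def\<close>)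

text \<open>Zero ranks force every gauge value to be the 0 x 0 matrix, and outside the carrier both
  gauges are fixed by extensionality.\<close>

lemma is_mor1_zero:
  assumes "is_mor1 n m R s" "R = 0\<^sub>m m n"
  shows "(R, s) = zero1 n m"
proof -
  have "s a = trivial_gauge R a" for a
  proof (cases "a \<in> carrier_vec n")
    case True
    have "s a $ i = 1\<^sub>m 0" "(R *\<^sub>v a) $ i = 0" if "i < m" for i
      using is_mor1D(3)[OF assms(1) True that] index_mult_mat_vec_sum[OF is_mor1D(1)[OF assms(1)] True that]
        assms(2) that by (auto simp: mutual_inv_def dest: carrier_mat_0_eq simp del: index_mult_mat_vec)
    moreover have "s a \<in> carrier_vec m"
      using is_mor1D(2)[OF assms(1)] True by auto
    ultimately show ?thesis
      using True assms(2) by (intro eq_vecI) (auto simp: trivial_gauge_def simp del: index_mult_mat_vec)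
  next
    case False
    then show ?thesis
      using is_mor1D(2)[OF assms(1)] assms(2) by (auto simp: trivial_gauge_def PiE_def extensional_def)
  qed
  then show ?thesis
    using assms(2) by (auto simp: zero1_def)
qed

lemma hom1_iff: "f \<in> hom1 n m \<longleftrightarrow> is_mor1 n m (fst f) (snd f)"
proof (cases "n = 0 \<or> m = 0")
  case True
  \<comment> \<open>A matrix without rows or without columns is the zero matrix.\<close>
  have "(R, s) = zero1 n m" if "is_mor1 n m R s" for R s
    using is_mor1D(1)[OF that] True by (intro is_mor1_zero[OF that] eq_matI) auto
  moreover have "is_mor1 n m (fst (zero1 n m)) (snd (zero1 n m))"
    using trivial_is_mor1[OF zero_carrier_mat] by (simp add: zero1_def)
  moreover have "hom1 n m = {zero1 n m}"
    using True by (simp add: hom1_def)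
  ultimately show ?thesis
    by (metis prod.collapse singleton_iff)
next
  case False
  then show ?thesis
    by (simp add: hom1_def is_mor1_def case_prod_unfold)
qed

lemma hom2_iff:
  "T \<in> hom2 n m f f' \<longleftrightarrow> T \<in> carrier_mat m n \<and>
    (\<forall>i<m. \<forall>j<n. T $$ (i, j) \<in> carrier_mat (fst f' $$ (i, j)) (fst f $$ (i, j)))"
proof (cases "n = 0 \<or> m = 0")
  case True
  then have "T = zero2 n m \<longleftrightarrow> T \<in> carrier_mat m n"
    by (auto simp: zero2_def)
  then show ?thesis
    using True by (auto simp: hom2_def case_prod_unfold)
qed (auto simp: hom2_def case_prod_unfold)

lemma id_mor1_eq: "id_mor1 n = (1\<^sub>m n, trivial_gauge (1\<^sub>m n))"
proof (cases "n = 0")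
  case True
  have "(0\<^sub>m 0 0 :: nat mat) = 1\<^sub>m 0" by (intro eq_matI) auto
  with True show ?thesis by (simp add: id_mor1_def zero1_def)
qed (simp add: id_mor1_def)

lemma id_mor2_eq: "id_mor2 n m f = mat m n (\<lambda>(i, j). 1\<^sub>m (fst f $$ (i, j)))"
  by (cases f) (auto simp: id_mor2_def zero2_def)

lemma vcomp_mor2_eq:
  "vcomp_mor2 n m f f' f'' T' T = mat m n (\<lambda>(i, j). T' $$ (i, j) * T $$ (i, j))"
  by (auto simp: vcomp_mor2_def zero2_def)

section \<open>Composition of gauges\<close>

text \<open>From here on ranks serve as matrix sizes and are kept as atoms; unfolded to scalar
  products they would no longer match.\<close>

declare index_mult_mat_vec [simp del] index_mult_mat(1) [simp del]

lemma gauge_comp_index: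
  assumes "a \<in> carrier_vec n" "k < p"
  shows "gauge_comp n m p (S, t) (R, s) a $ k =
    t (R *\<^sub>v a) $ k * dsum m (\<lambda>i. kron (1\<^sub>m (S $$ (k, i))) (s a $ i)) * perm_mat (row S k) R a
    * dsum n (\<lambda>j. kron (minv (t (R *\<^sub>v unit_vec n j) $ k)) (1\<^sub>m (a $ j)))"
  using assms by (simp add: gauge_comp_def)

text \<open>The common size of the factors of a composite gauge, in the form in which each produces
  it: outer gauge, direct sum of inner gauges, permutation, direct sum of inverses.\<close>

lemma rank_comp:
  fixes S R :: "nat mat"
  assumes "S \<in> carrier_mat p m" "R \<in> carrier_mat m n" "a \<in> carrier_vec n" "k < p"
  shows "(S * R *\<^sub>v a) $ k = (S *\<^sub>v (R *\<^sub>v a)) $ k"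
    and "(S * R *\<^sub>v a) $ k = (\<Sum>i<m. S $$ (k, i) * (R *\<^sub>v a) $ i)"
    and "(S * R *\<^sub>v a) $ k = (\<Sum>i<m. row S k $ i * (\<Sum>j<n. R $$ (i, j) * a $ j))"
    and "(S * R *\<^sub>v a) $ k = (\<Sum>j<n. (S * R) $$ (k, j) * a $ j)"
proof -
  show 1: "(S * R *\<^sub>v a) $ k = (S *\<^sub>v (R *\<^sub>v a)) $ k"
    using assms by simp
  show 2: "(S * R *\<^sub>v a) $ k = (\<Sum>i<m. S $$ (k, i) * (R *\<^sub>v a) $ i)"
    unfolding 1 using assms by (intro index_mult_mat_vec_sum) auto
  show "(S * R *\<^sub>v a) $ k = (\<Sum>i<m. row S k $ i * (\<Sum>j<n. R $$ (i, j) * a $ j))"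
    unfolding 2 using assms by (intro sum.cong) (auto simp: index_mult_mat_vec_sum)
  show "(S * R *\<^sub>v a) $ k = (\<Sum>j<n. (S * R) $$ (k, j) * a $ j)"
    using assms by (intro index_mult_mat_vec_sum) auto
qed

lemma rank_unit:
  fixes R :: "nat mat"
  assumes "R \<in> carrier_mat m n" "i < m" "j < n"
  shows "(R *\<^sub>v unit_vec n j) $ i = R $$ (i, j)"
  using assms by (simp add: mult_mat_unit_vec)

lemma gauge_mutual_inv:
  assumes "is_mor1 m p S t" "R \<in> carrier_mat m n" "a \<in> carrier_vec n" "k < p"
  shows "mutual_inv ((S * R *\<^sub>v a) $ k) (t (R *\<^sub>v a) $ k) (minv (t (R *\<^sub>v a) $ k))"
  using is_mor1D(3)[OF assms(1) mult_mat_vec_carrier[OF assms(2,3)] assms(4)] assms is_mor1D(1)[OF assms(1)]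
  by simp

lemma gauge_mutual_inv_unit:
  assumes "is_mor1 m p S t" "R \<in> carrier_mat m n" "j < n" "k < p"
  shows "mutual_inv ((S * R) $$ (k, j)) (t (R *\<^sub>v unit_vec n j) $ k) (minv (t (R *\<^sub>v unit_vec n j) $ k))"
  using gauge_mutual_inv[OF assms(1,2) unit_vec_carrier[of n j] assms(4)] assms is_mor1D(1)[OF assms(1)]
  by (simp add: rank_unit[of "S * R" p n] del: assoc_mult_mat_vec)

text \<open>All four factors are invertible of one size, so their inverses multiply in reverse
  order. The inverse is written out because inverses of composite gauges occur inside iterated
  composites.\<close>

lemma gauge_comp_mutual_inv:
  assumes f: "is_mor1 n m R s" and g: "is_mor1 m p S t" and a: "a \<in> carrier_vec n" and k: "k < p"
  shows "mutual_inv ((S * R *\<^sub>v a) $ k) (gauge_comp n m p (S, t) (R, s) a $ k)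
    (dsum n (\<lambda>j. kron (t (R *\<^sub>v unit_vec n j) $ k) (1\<^sub>m (a $ j)))
     * (minv (perm_mat (row S k) R a)
        * (dsum m (\<lambda>i. kron (1\<^sub>m (S $$ (k, i))) (minv (s a $ i))) * minv (t (R *\<^sub>v a) $ k))))"
proof -
  note R = is_mor1D(1)[OF f] and S = is_mor1D(1)[OF g]
  note rank = rank_comp[OF S R a k]
  have "mutual_inv ((S * R *\<^sub>v a) $ k) (dsum m (\<lambda>i. kron (1\<^sub>m (S $$ (k, i))) (s a $ i)))
      (dsum m (\<lambda>i. kron (1\<^sub>m (S $$ (k, i))) (minv (s a $ i))))"
    unfolding rank(2) using is_mor1D(3)[OF f a]
    by (intro mutual_inv_dsum mutual_inv_kron[OF mutual_inv_one] refl) auto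
  moreover have "mutual_inv ((S * R *\<^sub>v a) $ k) (perm_mat (row S k) R a) (minv (perm_mat (row S k) R a))"
    using S R a k rank(3) by (intro perm_mat_mutual_inv) auto
  moreover have "mutual_inv ((S * R *\<^sub>v a) $ k)
      (dsum n (\<lambda>j. kron (minv (t (R *\<^sub>v unit_vec n j) $ k)) (1\<^sub>m (a $ j))))
      (dsum n (\<lambda>j. kron (t (R *\<^sub>v unit_vec n j) $ k) (1\<^sub>m (a $ j))))"
    unfolding rank(4)
    by (rule mutual_inv_sym, rule mutual_inv_dsum[OF mutual_inv_kron[OF gauge_mutual_inv_unit[OF g R _ k] mutual_inv_one refl] refl])
  ultimately show ?thesis
    unfolding gauge_comp_index[OF a k]
    by (intro mutual_inv_mult gauge_mutual_inv[OF g R a k])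
qed

lemma comp_is_mor1:
  assumes f: "is_mor1 n m R s" and g: "is_mor1 m p S t"
  shows "is_mor1 n p (S * R) (gauge_comp n m p (S, t) (R, s))"
proof (rule is_mor1I)
  note R = is_mor1D(1)[OF f] and S = is_mor1D(1)[OF g]
  show "S * R \<in> carrier_mat p n"
    using R S by simp
  show "gauge_comp n m p (S, t) (R, s) \<in> carrier_vec n \<rightarrow>\<^sub>E carrier_vec p"
    by (auto simp: gauge_comp_def)
  show "mutual_inv ((S * R *\<^sub>v a) $ k) (gauge_comp n m p (S, t) (R, s) a $ k)
      (minv (gauge_comp n m p (S, t) (R, s) a $ k))" if "a \<in> carrier_vec n" "k < p" for a k
    using gauge_comp_mutual_inv[OF f g that] mutual_inv_minv[OF gauge_comp_mutual_inv[OF f g that]]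
    by simp
  \<comment> \<open>At a unit vector the two middle factors are identities and the last one
    collapses to the inverse of the first: this is the purpose of the last factor.\<close>
  show "gauge_comp n m p (S, t) (R, s) (unit_vec n j) $ k = 1\<^sub>m ((S * R) $$ (k, j))" if "k < p" "j < n" for k j
  proof -
    let ?N = "(S * R) $$ (k, j)"
    have N: "?N = (\<Sum>i<m. S $$ (k, i) * R $$ (i, j))"
      using R S that by (simp add: index_mult_mat_sum)
    have 1: "dsum m (\<lambda>i. kron (1\<^sub>m (S $$ (k, i))) (s (unit_vec n j) $ i)) = 1\<^sub>m ?N"
    proof -
      have "dsum m (\<lambda>i. kron (1\<^sub>m (S $$ (k, i))) (s (unit_vec n j) $ i))
          = dsum m (\<lambda>i. 1\<^sub>m (S $$ (k, i) * R $$ (i, j)))"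
        using is_mor1D(4)[OF f] that by (intro dsum_cong) (auto simp: kron_one)
      then show ?thesis
        by (simp add: dsum_one N)
    qed
    have 2: "perm_mat (row S k) R (unit_vec n j) = 1\<^sub>m ?N"
      using that R S N by (intro perm_mat_unit_col[of _ m _ n]) auto
    note t = gauge_mutual_inv_unit[OF g R that(2,1)]
    have 3: "dsum n (\<lambda>j'. kron (minv (t (R *\<^sub>v unit_vec n j') $ k)) (1\<^sub>m (unit_vec n j $ j')))
        = minv (t (R *\<^sub>v unit_vec n j) $ k)"
    proof -
      have "dsum n (\<lambda>j'. kron (minv (t (R *\<^sub>v unit_vec n j') $ k)) (1\<^sub>m (unit_vec n j $ j')))
        = kron (minv (t (R *\<^sub>v unit_vec n j) $ k)) (1\<^sub>m (unit_vec n j $ j))"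
        \<comment> \<open>For \<open>j' \<noteq> j\<close> the block is a Kronecker product with the
          0 x 0 identity, hence empty.\<close>
        using that by (intro dsum_single) (auto simp: kron_def)
      then show ?thesis
        using that by simp
    qed
    show ?thesis
      unfolding gauge_comp_index[OF unit_vec_carrier that(1)] 1 2 3
      using mutual_invD[OF t] by simp
  qed
qed

lemma minv_gauge_comp:
  assumes "is_mor1 n m R s" "is_mor1 m p S t" "a \<in> carrier_vec n" "k < p"
  shows "minv (gauge_comp n m p (S, t) (R, s) a $ k) =
    dsum n (\<lambda>j. kron (t (R *\<^sub>v unit_vec n j) $ k) (1\<^sub>m (a $ j)))
     * (minv (perm_mat (row S k) R a)
        * (dsum m (\<lambda>i. kron (1\<^sub>m (S $$ (k, i))) (minv (s a $ i))) * minv (t (R *\<^sub>v a) $ k)))"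
  by (rule mutual_inv_minv[OF gauge_comp_mutual_inv[OF assms]])

text \<open>Splits an identity into blocks, the shape that naturality asks for; read backwards, it
  merges the factors that become trivial in the unit laws.\<close>

lemma one_mat_rank:
  fixes R :: "nat mat"
  assumes "R \<in> carrier_mat m n" "a \<in> carrier_vec n" "i < m"
  shows "(1\<^sub>m ((R *\<^sub>v a) $ i) :: complex mat) = dsum n (\<lambda>j. kron (1\<^sub>m (R $$ (i, j))) (1\<^sub>m (a $ j)))"
  using assms by (simp add: kron_one dsum_one index_mult_mat_vec_sum)

text \<open>The left side expands to \<open>W Dt Ds DP Di P1 Ew\<close>, the right side to
  \<open>W Dt P3 F Gs P2 EG EQ Et Ew\<close>. Naturality moves \<open>Di\<close> across
  \<open>P1\<close>, \<open>Ds\<close> across \<open>P3\<close> and \<open>F\<close> across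
  \<open>P2\<close>; coherence exchanges the permutations; \<open>F\<close> and \<open>Gs\<close>
  commute because they act on different Kronecker factors.\<close>

lemma gauge_comp_assoc_index:
  assumes f: "is_mor1 n m R s" and g: "is_mor1 m p S t" and h: "is_mor1 p q T w"
    and a: "a \<in> carrier_vec n" and l: "l < q"
  shows "gauge_comp n p q (T, w) (S * R, gauge_comp n m p (S, t) (R, s)) a $ l
    = gauge_comp n m q (T * S, gauge_comp m p q (T, w) (S, t)) (R, s) a $ l"
proof -
  note R = is_mor1D(1)[OF f] and S = is_mor1D(1)[OF g] and T = is_mor1D(1)[OF h]
  have SR: "S * R \<in> carrier_mat p n" and TS: "T * S \<in> carrier_mat q m"
    using R S T by auto
  have Ra: "R *\<^sub>v a \<in> carrier_vec m"
    using R a by simp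
  have Re: "R *\<^sub>v unit_vec n j \<in> carrier_vec m" for j
    using R by simp
  define N where "N = (T * S * R *\<^sub>v a) $ l"
  let ?r = "row T l"
  have r: "?r \<in> carrier_vec p"
    using T by auto
  have [simp]: "?r $ k = T $$ (l, k)" if "k < p" for k
    using T l that by simp
  have TSR: "T * S * R = T * (S * R)"
    using R S T by simp
  have q: "row (T * S) l \<in> carrier_vec m" "\<And>i. i < m \<Longrightarrow> row (T * S) l $ i = (\<Sum>k<p. ?r $ k * S $$ (k, i))"
    using T S l by (auto simp: scalar_prod_def atLeast0LessThan)

  have rTS: "row (T * S) l $ i = (T * S) $$ (l, i)" if "i < m" for i
    using S T l that by (subst index_row(1)) auto

  \<comment> \<open>The prefix \<open>D\<close> marks direct sums over \<open>k\<close>, the prefix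
    \<open>E\<close> those over \<open>j\<close>; \<open>F\<close> and \<open>Gs\<close> are sums
    over \<open>i\<close>. \<open>EP\<close>, \<open>EQ\<close> and \<open>EG\<close>,
    \<open>EF\<close> are inverse pairs.\<close>
  define W where "W = w (S *\<^sub>v (R *\<^sub>v a)) $ l"
  define Dt where "Dt = dsum p (\<lambda>k. kron (1\<^sub>m (T $$ (l, k))) (t (R *\<^sub>v a) $ k))"
  define Ds where "Ds = dsum p (\<lambda>k. kron (1\<^sub>m (T $$ (l, k)))
    (dsum m (\<lambda>i. kron (1\<^sub>m (S $$ (k, i))) (s a $ i))))"
  define DP where "DP = dsum p (\<lambda>k. kron (1\<^sub>m (T $$ (l, k))) (perm_mat (row S k) R a))"
  define Di where "Di = dsum p (\<lambda>k. kron (1\<^sub>m (T $$ (l, k)))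
    (dsum n (\<lambda>j. kron (minv (t (R *\<^sub>v unit_vec n j) $ k)) (1\<^sub>m (a $ j)))))"
  define P1 where "P1 = perm_mat ?r (S * R) a"
  define P2 where "P2 = perm_mat (row (T * S) l) R a"
  define P3 where "P3 = perm_mat ?r S (R *\<^sub>v a)"
  define Ew where "Ew = dsum n (\<lambda>j. kron (minv (w (S *\<^sub>v (R *\<^sub>v unit_vec n j)) $ l)) (1\<^sub>m (a $ j)))"
  define Et where "Et = dsum n (\<lambda>j. kron (dsum p (\<lambda>k. kron (1\<^sub>m (T $$ (l, k)))
    (minv (t (R *\<^sub>v unit_vec n j) $ k)))) (1\<^sub>m (a $ j)))"
  define EP where "EP = dsum n (\<lambda>j. kron (perm_mat ?r S (R *\<^sub>v unit_vec n j)) (1\<^sub>m (a $ j)))"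
  define EQ where "EQ = dsum n (\<lambda>j. kron (minv (perm_mat ?r S (R *\<^sub>v unit_vec n j))) (1\<^sub>m (a $ j)))"
  define Gs where "Gs = dsum m (\<lambda>i. kron (1\<^sub>m ((T * S) $$ (l, i))) (s a $ i))"
  define F where "F = dsum m (\<lambda>i. kron (minv (w (S *\<^sub>v unit_vec m i) $ l)) (1\<^sub>m ((R *\<^sub>v a) $ i)))"
  define EF where "EF = dsum n (\<lambda>j. kron (dsum m (\<lambda>i. kron (minv (w (S *\<^sub>v unit_vec m i) $ l))
    (1\<^sub>m (R $$ (i, j))))) (1\<^sub>m (a $ j)))"
  define EG where "EG = dsum n (\<lambda>j. kron (dsum m (\<lambda>i. kron (w (S *\<^sub>v unit_vec m i) $ l)
    (1\<^sub>m ((R *\<^sub>v unit_vec n j) $ i)))) (1\<^sub>m (a $ j)))"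

  have sa: "s a $ i \<in> carrier_mat ((R *\<^sub>v a) $ i) ((R *\<^sub>v a) $ i)" if "i < m" for i
    using mutual_invD(1)[OF is_mor1D(3)[OF f a that]] .
  have tRa: "t (R *\<^sub>v a) $ k \<in> carrier_mat ((S * R *\<^sub>v a) $ k) ((S * R *\<^sub>v a) $ k)" if "k < p" for k
    using mutual_invD(1)[OF gauge_mutual_inv[OF g R a that]] .
  have tRe: "minv (t (R *\<^sub>v unit_vec n j) $ k) \<in> carrier_mat ((S * R) $$ (k, j)) ((S * R) $$ (k, j))"
    if "k < p" "j < n" for k j
    using mutual_invD(2)[OF gauge_mutual_inv_unit[OF g R that(2,1)]] .
  have wSe: "mutual_inv ((T * S) $$ (l, i)) (w (S *\<^sub>v unit_vec m i) $ l) (minv (w (S *\<^sub>v unit_vec m i) $ l))"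
    if "i < m" for i
    by (rule gauge_mutual_inv_unit[OF h S that l])
  have wSRe: "mutual_inv ((T * S * R) $$ (l, j)) (w (S *\<^sub>v (R *\<^sub>v unit_vec n j)) $ l)
      (minv (w (S *\<^sub>v (R *\<^sub>v unit_vec n j)) $ l))"
    if "j < n" for j
    using gauge_mutual_inv_unit[OF h SR that l] R S T by simp
  note N1 = rank_comp[OF TS R a l, folded N_def]
  note N2 = rank_comp[OF T SR a l, folded TSR, folded N_def]

  have W: "W \<in> carrier_mat N N"
    using mutual_invD(1)[OF gauge_mutual_inv[OF h SR a l]] R S T a by (simp add: W_def N_def)
  have Dt: "Dt \<in> carrier_mat N N"
    unfolding Dt_def by (rule dsum_carrier[OF kron_carrier[OF one_carrier_mat tRa refl refl] N2(2) N2(2)])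
  have DsI: "dsum m (\<lambda>i. kron (1\<^sub>m (S $$ (k, i))) (s a $ i))
      \<in> carrier_mat ((S * R *\<^sub>v a) $ k) ((S * R *\<^sub>v a) $ k)" if "k < p" for k
    by (rule dsum_carrier[OF kron_carrier[OF one_carrier_mat sa refl refl]
          rank_comp(2)[OF S R a that] rank_comp(2)[OF S R a that]])
  have Ds: "Ds \<in> carrier_mat N N"
    unfolding Ds_def by (rule dsum_carrier[OF kron_carrier[OF one_carrier_mat DsI refl refl] N2(2) N2(2)])
  have DPI: "perm_mat (row S k) R a \<in> carrier_mat ((S * R *\<^sub>v a) $ k) ((S * R *\<^sub>v a) $ k)" if "k < p" for k
    using S rank_comp(3)[OF S R a that] by (intro perm_mat_carrier[OF _ R a]) auto
  have DP: "DP \<in> carrier_mat N N"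
    unfolding DP_def by (rule dsum_carrier[OF kron_carrier[OF one_carrier_mat DPI refl refl] N2(2) N2(2)])
  have DiI: "dsum n (\<lambda>j. kron (minv (t (R *\<^sub>v unit_vec n j) $ k)) (1\<^sub>m (a $ j)))
      \<in> carrier_mat ((S * R *\<^sub>v a) $ k) ((S * R *\<^sub>v a) $ k)" if "k < p" for k
    by (rule dsum_carrier[OF kron_carrier[OF tRe[OF that] one_carrier_mat refl refl]
          rank_comp(4)[OF S R a that] rank_comp(4)[OF S R a that]])
  have Di: "Di \<in> carrier_mat N N"
    unfolding Di_def by (rule dsum_carrier[OF kron_carrier[OF one_carrier_mat DiI refl refl] N2(2) N2(2)])
  have P1: "P1 \<in> carrier_mat N N"
    unfolding P1_def by (rule perm_mat_carrier[OF r SR a N2(3)])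
  have P2: "P2 \<in> carrier_mat N N"
    unfolding P2_def by (rule perm_mat_carrier[OF q(1) R a N1(3)])
  have N3: "N = (\<Sum>k<p. ?r $ k * (\<Sum>i<m. S $$ (k, i) * (R *\<^sub>v a) $ i))"
    unfolding N2(2) using rank_comp(2)[OF S R a] by simp
  have P3: "P3 \<in> carrier_mat N N"
    unfolding P3_def by (rule perm_mat_carrier[OF r S Ra N3])
  have Ew: "Ew \<in> carrier_mat N N"
    unfolding Ew_def
    by (rule dsum_carrier[OF kron_carrier[OF mutual_invD(2)[OF wSRe] one_carrier_mat refl refl] N1(4) N1(4)])
  have EtI: "dsum p (\<lambda>k. kron (1\<^sub>m (T $$ (l, k))) (minv (t (R *\<^sub>v unit_vec n j) $ k)))
      \<in> carrier_mat ((T * S * R) $$ (l, j)) ((T * S * R) $$ (l, j))" if "j < n" for j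
    using index_mult_mat_sum[OF T SR l that] unfolding TSR
    by (intro dsum_carrier[OF kron_carrier[OF one_carrier_mat tRe[OF _ that] refl refl]]) auto
  have Et: "Et \<in> carrier_mat N N"
    unfolding Et_def by (rule dsum_carrier[OF kron_carrier[OF EtI one_carrier_mat refl refl] N1(4) N1(4)])
  have EPI: "mutual_inv ((T * S * R) $$ (l, j)) (perm_mat ?r S (R *\<^sub>v unit_vec n j))
      (minv (perm_mat ?r S (R *\<^sub>v unit_vec n j)))" if "j < n" for j
  proof (rule perm_mat_mutual_inv[OF r S Re])
    have "(T * S * R) $$ (l, j) = (\<Sum>k<p. T $$ (l, k) * (\<Sum>i<m. S $$ (k, i) * R $$ (i, j)))"
      unfolding TSR using index_mult_mat_sum[OF T SR l that] index_mult_mat_sum[OF S R _ that] by simp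
    then show "(T * S * R) $$ (l, j)
        = (\<Sum>k<p. ?r $ k * (\<Sum>i<m. S $$ (k, i) * (R *\<^sub>v unit_vec n j) $ i))"
      using R that by (simp add: rank_unit)
  qed
  have EP: "mutual_inv N EP EQ"
    unfolding EP_def EQ_def
    by (rule mutual_inv_dsum[OF mutual_inv_kron[OF EPI mutual_inv_one refl] N1(4)])
  have EFI: "mutual_inv ((T * S * R) $$ (l, j))
      (dsum m (\<lambda>i. kron (w (S *\<^sub>v unit_vec m i) $ l) (1\<^sub>m ((R *\<^sub>v unit_vec n j) $ i))))
      (dsum m (\<lambda>i. kron (minv (w (S *\<^sub>v unit_vec m i) $ l)) (1\<^sub>m ((R *\<^sub>v unit_vec n j) $ i))))" if "j < n" for j
    using index_mult_mat_sum[OF TS R l that] rank_unit[OF R _ that]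
    by (intro mutual_inv_dsum[OF mutual_inv_kron[OF wSe mutual_inv_one refl]]) auto
  \<comment> \<open>\<open>R $$ (i, j)\<close> equals \<open>(R *\<^sub>v unit_vec n j) $ i\<close>;
    the first form suits naturality, the second the inverse \<open>EG\<close>.\<close>
  have EF_eq: "EF = dsum n (\<lambda>j. kron (dsum m (\<lambda>i. kron (minv (w (S *\<^sub>v unit_vec m i) $ l))
    (1\<^sub>m ((R *\<^sub>v unit_vec n j) $ i)))) (1\<^sub>m (a $ j)))"
    unfolding EF_def using rank_unit[OF R] by (intro dsum_cong arg_cong2[where f = kron]) auto
  have EG: "mutual_inv N EG EF"
    unfolding EG_def EF_eq
    by (rule mutual_inv_dsum[OF mutual_inv_kron[OF EFI mutual_inv_one refl] N1(4)])
  have Gs: "Gs \<in> carrier_mat N N"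
    unfolding Gs_def by (rule dsum_carrier[OF kron_carrier[OF one_carrier_mat sa refl refl] N1(2) N1(2)])
  have F: "F \<in> carrier_mat N N"
    unfolding F_def
    by (rule dsum_carrier[OF kron_carrier[OF mutual_invD(2)[OF wSe] one_carrier_mat refl refl] N1(2) N1(2)])

  note carr = W Dt Ds DP Di P1 P2 P3 Ew Et Gs F mutual_invD(1,2)[OF EP] mutual_invD(1,2)[OF EG]
  note assoc = assoc_mult_mat[of _ N N _ N _ N]

  \<comment> \<open>Naturality with identities as \<open>X\<close> and \<open>M\<close>.\<close>
  have Di_P1: "Di * P1 = P1 * Et"
  proof -
    have "P1 * dsum n (\<lambda>j. kron (dsum p (\<lambda>k. kron (1\<^sub>m (?r $ k))
        (minv (t (R *\<^sub>v unit_vec n j) $ k)))) (1\<^sub>m (a $ j)))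
      = dsum p (\<lambda>k. kron (1\<^sub>m (?r $ k)) (dsum n (\<lambda>j. kron (minv (t (R *\<^sub>v unit_vec n j) $ k)) (1\<^sub>m (a $ j))))) * P1"
      unfolding P1_def by (rule perm_mat_natural[OF r SR a r SR a]) (use tRe in auto)
    then show ?thesis
      by (simp add: Di_def Et_def cong: dsum_cong)
  qed
  \<comment> \<open>Naturality with inverse values of \<open>w\<close> as \<open>X\<close> and
    identities as \<open>Y\<close> and \<open>M\<close>; \<open>one_mat_rank\<close> then merges the
    inner sum.\<close>
  have F_P2: "F * P2 = P2 * EF"
  proof -
    have "P2 * EF = dsum m (\<lambda>i. kron (minv (w (S *\<^sub>v unit_vec m i) $ l))
        (dsum n (\<lambda>j. kron (1\<^sub>m (R $$ (i, j))) (1\<^sub>m (a $ j))))) * P2"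
      unfolding P2_def EF_def
      by (rule perm_mat_natural[OF q(1) R a q(1) R a]) (use mutual_invD(2)[OF wSe] rTS in auto)
    also have "dsum m (\<lambda>i. kron (minv (w (S *\<^sub>v unit_vec m i) $ l))
        (dsum n (\<lambda>j. kron (1\<^sub>m (R $$ (i, j))) (1\<^sub>m (a $ j))))) = F"
      unfolding F_def by (intro dsum_cong arg_cong2[where f = kron] refl one_mat_rank[OF R a, symmetric])
    finally show ?thesis ..
  qed
  \<comment> \<open>Naturality with identities as \<open>X\<close> and \<open>Y\<close> and the
    gauge \<open>s\<close> as \<open>M\<close>.\<close>
  have P3_Gs: "P3 * Gs = Ds * P3"
  proof -
    have "P3 * dsum m (\<lambda>i. kron (dsum p (\<lambda>k. kron (1\<^sub>m (?r $ k)) (1\<^sub>m (S $$ (k, i))))) (s a $ i))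
      = dsum p (\<lambda>k. kron (1\<^sub>m (?r $ k)) (dsum m (\<lambda>i. kron (1\<^sub>m (S $$ (k, i))) (s a $ i)))) * P3"
      unfolding P3_def by (rule perm_mat_natural[OF r S Ra r S Ra]) (use sa in auto)
    moreover have "dsum p (\<lambda>k. kron (1\<^sub>m (?r $ k)) (1\<^sub>m (S $$ (k, i)))) = (1\<^sub>m ((T * S) $$ (l, i)) :: complex mat)"
      if "i < m" for i
      using index_mult_mat_sum[OF T S l that] by (simp add: kron_one dsum_one)
    ultimately show ?thesis
      by (simp add: Gs_def Ds_def cong: dsum_cong)
  qed
  have F_Gs: "F * Gs = Gs * F"
  proof -
    have "F * Gs = dsum m (\<lambda>i. kron (minv (w (S *\<^sub>v unit_vec m i) $ l)) (1\<^sub>m ((R *\<^sub>v a) $ i))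
        * kron (1\<^sub>m ((T * S) $$ (l, i))) (s a $ i))"
      unfolding F_def Gs_def
      by (rule dsum_mult[OF kron_carrier[OF mutual_invD(2)[OF wSe] one_carrier_mat refl refl]
            kron_carrier[OF one_carrier_mat sa refl refl]])
    also have "\<dots> = dsum m (\<lambda>i. kron (1\<^sub>m ((T * S) $$ (l, i))) (s a $ i)
        * kron (minv (w (S *\<^sub>v unit_vec m i) $ l)) (1\<^sub>m ((R *\<^sub>v a) $ i)))"
    proof (intro dsum_cong refl)
      fix i assume i: "i < m"
      note w = mutual_invD(2)[OF wSe[OF i]]
      show "kron (minv (w (S *\<^sub>v unit_vec m i) $ l)) (1\<^sub>m ((R *\<^sub>v a) $ i)) * kron (1\<^sub>m ((T * S) $$ (l, i))) (s a $ i)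
        = kron (1\<^sub>m ((T * S) $$ (l, i))) (s a $ i) * kron (minv (w (S *\<^sub>v unit_vec m i) $ l)) (1\<^sub>m ((R *\<^sub>v a) $ i))"
        using w sa[OF i] kron_mult[OF w one_carrier_mat one_carrier_mat sa[OF i]]
          kron_mult[OF one_carrier_mat w sa[OF i] one_carrier_mat] by simp
    qed
    also have "\<dots> = Gs * F"
      unfolding F_def Gs_def
      by (rule dsum_mult[OF kron_carrier[OF one_carrier_mat sa refl refl]
            kron_carrier[OF mutual_invD(2)[OF wSe] one_carrier_mat refl refl], symmetric])
    finally show ?thesis .
  qed
  have coh: "DP * P1 * EP = P3 * P2"
    using perm_mat_coherent[OF r S R a q] unfolding DP_def P1_def EP_def P2_def P3_def
    by (simp cong: dsum_cong)

  have D: "dsum p (\<lambda>k. kron (1\<^sub>m (T $$ (l, k))) (gauge_comp n m p (S, t) (R, s) a $ k)) = Dt * Ds * DP * Di"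
  proof -
    have "dsum p (\<lambda>k. kron (1\<^sub>m (T $$ (l, k))) (gauge_comp n m p (S, t) (R, s) a $ k))
      = dsum p (\<lambda>k. kron (1\<^sub>m (T $$ (l, k))) (t (R *\<^sub>v a) $ k
          * dsum m (\<lambda>i. kron (1\<^sub>m (S $$ (k, i))) (s a $ i)) * perm_mat (row S k) R a
          * dsum n (\<lambda>j. kron (minv (t (R *\<^sub>v unit_vec n j) $ k)) (1\<^sub>m (a $ j)))))"
      using a by (intro dsum_cong) (auto simp: gauge_comp_index)
    also have "\<dots> = Dt * Ds * DP * Di"
      unfolding Dt_def Ds_def DP_def Di_def
      using tRa DsI DPI DiI
      \<comment> \<open>Each round separates one more factor and settles its size
        conditions.\<close>
      by (subst dsum_one_kron_mult[where b = "\<lambda>k. (S * R *\<^sub>v a) $ k" and c = "\<lambda>k. (S * R *\<^sub>v a) $ k" and d = "\<lambda>k. (S * R *\<^sub>v a) $ k"];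
          (auto intro!: mult_carrier_mat)?)+
    finally show ?thesis .
  qed
  have E: "dsum n (\<lambda>j. kron (minv (gauge_comp m p q (T, w) (S, t) (R *\<^sub>v unit_vec n j) $ l)) (1\<^sub>m (a $ j)))
    = EG * (EQ * (Et * Ew))"
  proof -
    let ?c = "\<lambda>j. (T * S * R) $$ (l, j)"
    have "dsum n (\<lambda>j. kron (minv (gauge_comp m p q (T, w) (S, t) (R *\<^sub>v unit_vec n j) $ l)) (1\<^sub>m (a $ j)))
      = dsum n (\<lambda>j. kron (dsum m (\<lambda>i. kron (w (S *\<^sub>v unit_vec m i) $ l) (1\<^sub>m ((R *\<^sub>v unit_vec n j) $ i)))
          * (minv (perm_mat ?r S (R *\<^sub>v unit_vec n j))
          * (dsum p (\<lambda>k. kron (1\<^sub>m (T $$ (l, k))) (minv (t (R *\<^sub>v unit_vec n j) $ k)))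
          * minv (w (S *\<^sub>v (R *\<^sub>v unit_vec n j)) $ l)))) (1\<^sub>m (a $ j)))"
      using minv_gauge_comp[OF g h Re l] by simp
    also have "\<dots> = EG * (EQ * (Et * Ew))"
      unfolding EG_def EQ_def Et_def Ew_def
      using mutual_invD(1)[OF EFI] mutual_invD(2)[OF EPI] EtI mutual_invD(2)[OF wSRe]
      by (subst dsum_kron_one_mult[where b = ?c and c = ?c and d = ?c]; (auto intro!: mult_carrier_mat)?)+
    finally show ?thesis .
  qed
  have "gauge_comp n p q (T, w) (S * R, gauge_comp n m p (S, t) (R, s)) a $ l = W * (Dt * Ds * DP * Di) * P1 * Ew"
    unfolding gauge_comp_index[OF a l] D W_def P1_def Ew_def using R S a
    by (simp cong: dsum_cong)
  also have "\<dots> = W * Dt * Ds * DP * (Di * P1) * Ew"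
    using carr by (simp add: assoc)
  also have "\<dots> = W * Dt * Ds * (DP * P1) * Et * Ew"
    unfolding Di_P1 using carr by (simp add: assoc)
  \<comment> \<open>\<open>EP * EQ\<close> is inserted to make coherence applicable, and next
    \<open>EF * EG\<close>, so that \<open>EF\<close> can cross \<open>P2\<close>.\<close>
  also have "DP * P1 = DP * P1 * EP * EQ"
    using carr mutual_invD(3)[OF EP] by (simp add: assoc)
  also have "\<dots> = P3 * (P2 * (EF * EG)) * EQ"
    unfolding coh using carr mutual_invD(4)[OF EG] by (simp add: assoc)
  also have "W * Dt * Ds * \<dots> * Et * Ew = W * Dt * (Ds * P3) * (P2 * EF) * EG * EQ * Et * Ew"
    using carr by (simp add: assoc)
  also have "\<dots> = W * Dt * P3 * (Gs * F) * P2 * EG * EQ * Et * Ew"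
    unfolding P3_Gs[symmetric] F_P2[symmetric] using carr by (simp add: assoc)
  also have "\<dots> = W * Dt * P3 * F * Gs * P2 * (EG * (EQ * (Et * Ew)))"
    unfolding F_Gs[symmetric] using carr by (simp add: assoc)
  also have "\<dots> = gauge_comp n m q (T * S, gauge_comp m p q (T, w) (S, t)) (R, s) a $ l"
    unfolding gauge_comp_index[OF a l] gauge_comp_index[OF Ra l] E W_def Dt_def P3_def F_def Gs_def P2_def ..
  finally show ?thesis .
qed

text \<open>The outer gauge is trivial, so are its inverses and the permutation, and the only
  nonempty block of the direct sum is \<open>s a $ k\<close>.\<close>

lemma gauge_comp_id_left:
  assumes f: "is_mor1 n m R s"
  shows "gauge_comp n m m (1\<^sub>m m, trivial_gauge (1\<^sub>m m)) (R, s) = s"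
proof
  fix a
  note R = is_mor1D(1)[OF f]
  show "gauge_comp n m m (1\<^sub>m m, trivial_gauge (1\<^sub>m m)) (R, s) a = s a"
  proof (cases "a \<in> carrier_vec n")
    case a: True
    have s: "s a \<in> carrier_vec m"
      using is_mor1D(2)[OF f] a by auto
    have "gauge_comp n m m (1\<^sub>m m, trivial_gauge (1\<^sub>m m)) (R, s) a $ k = s a $ k" if k: "k < m" for k
    proof -
      let ?c = "(R *\<^sub>v a) $ k"
      have 1: "trivial_gauge (1\<^sub>m m) (R *\<^sub>v b) $ k = 1\<^sub>m ((R *\<^sub>v b) $ k)" if "b \<in> carrier_vec n" for b
        using R k that by (simp add: trivial_gauge_def)
      have 2: "dsum m (\<lambda>i. kron (1\<^sub>m (1\<^sub>m m $$ (k, i))) (s a $ i)) = s a $ k"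
        using k by (subst dsum_single[of k]) (auto simp: kron_def)
      have 3: "perm_mat (row (1\<^sub>m m) k) R a = 1\<^sub>m ?c"
        using k R a by (simp add: row_one perm_mat_unit_row index_mult_mat_vec_sum)
      have "dsum n (\<lambda>j. kron (minv (trivial_gauge (1\<^sub>m m) (R *\<^sub>v unit_vec n j) $ k)) (1\<^sub>m (a $ j)))
          = dsum n (\<lambda>j. kron (1\<^sub>m (R $$ (k, j))) (1\<^sub>m (a $ j)))"
        using R k by (intro dsum_cong) (auto simp: 1 rank_unit)
      also have "\<dots> = 1\<^sub>m ?c"
        by (rule one_mat_rank[OF R a k, symmetric])
      finally show ?thesis
        unfolding gauge_comp_index[OF a k] 1[OF a] 2 3
        using mutual_invD(1)[OF is_mor1D(3)[OF f a k]] by simp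
    qed
    with s show ?thesis
      using a by (intro eq_vecI) (auto simp: gauge_comp_def)
  next
    case False
    then show ?thesis
      using is_mor1D(2)[OF f] by (auto simp: gauge_comp_def PiE_def extensional_def)
  qed
qed

text \<open>The last factor is an identity because \<open>s\<close> is normalised at unit vectors;
  what survives is the outer gauge value.\<close>

lemma gauge_comp_id_right:
  assumes f: "is_mor1 n m R s"
  shows "gauge_comp n n m (R, s) (1\<^sub>m n, trivial_gauge (1\<^sub>m n)) = s"
proof
  fix a
  note R = is_mor1D(1)[OF f]
  show "gauge_comp n n m (R, s) (1\<^sub>m n, trivial_gauge (1\<^sub>m n)) a = s a"
  proof (cases "a \<in> carrier_vec n")
    case a: True
    have s: "s a \<in> carrier_vec m"
      using is_mor1D(2)[OF f] a by auto
    have "gauge_comp n n m (R, s) (1\<^sub>m n, trivial_gauge (1\<^sub>m n)) a $ k = s a $ k" if k: "k < m" for k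
    proof -
      let ?c = "(R *\<^sub>v a) $ k"
      have "dsum n (\<lambda>i. kron (1\<^sub>m (R $$ (k, i))) (trivial_gauge (1\<^sub>m n) a $ i))
          = dsum n (\<lambda>i. kron (1\<^sub>m (R $$ (k, i))) (1\<^sub>m (a $ i)))"
        using a by (intro dsum_cong) (auto simp: trivial_gauge_def)
      also have "\<dots> = 1\<^sub>m ?c"
        by (rule one_mat_rank[OF R a k, symmetric])
      finally have 2: "dsum n (\<lambda>i. kron (1\<^sub>m (R $$ (k, i))) (trivial_gauge (1\<^sub>m n) a $ i)) = 1\<^sub>m ?c" .
      have 3: "perm_mat (row R k) (1\<^sub>m n) a = 1\<^sub>m ?c"
        using k R a by (intro perm_mat_one) (auto simp: index_mult_mat_vec_sum)
      have "dsum n (\<lambda>j. kron (minv (s (1\<^sub>m n *\<^sub>v unit_vec n j) $ k)) (1\<^sub>m (a $ j)))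
          = dsum n (\<lambda>j. kron (1\<^sub>m (R $$ (k, j))) (1\<^sub>m (a $ j)))"
        using is_mor1D(4)[OF f k] by (intro dsum_cong) auto
      also have "\<dots> = 1\<^sub>m ?c"
        by (rule one_mat_rank[OF R a k, symmetric])
      finally show ?thesis
        unfolding gauge_comp_index[OF a k] 2 3
        using mutual_invD(1)[OF is_mor1D(3)[OF f a k]] a by simp
    qed
    with s show ?thesis
      using a by (intro eq_vecI) (auto simp: gauge_comp_def)
  next
    case False
    then show ?thesis
      using is_mor1D(2)[OF f] by (auto simp: gauge_comp_def PiE_def extensional_def)
  qed
qed

lemma gauge_comp_assoc:
  assumes "is_mor1 n m R s" "is_mor1 m p S t" "is_mor1 p q T w"
  shows "gauge_comp n p q (T, w) (S * R, gauge_comp n m p (S, t) (R, s))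
    = gauge_comp n m q (T * S, gauge_comp m p q (T, w) (S, t)) (R, s)"
proof
  fix a
  show "gauge_comp n p q (T, w) (S * R, gauge_comp n m p (S, t) (R, s)) a
    = gauge_comp n m q (T * S, gauge_comp m p q (T, w) (S, t)) (R, s) a"
  proof (cases "a \<in> carrier_vec n")
    case True
    then show ?thesis
      using gauge_comp_assoc_index[OF assms True]
      by (intro eq_vecI) (simp_all add: gauge_comp_def[of n])
  next
    case False
    then show ?thesis
      by (simp add: gauge_comp_def[of n])
  qed
qed

text \<open>If an object is 0, the product of ranks is a zero matrix (an empty sum for
  \<open>m = 0\<close>), and a zero rank matrix admits only the trivial gauge.\<close>

lemma comp_mor1_eq:
  assumes f: "is_mor1 n m R s" and g: "is_mor1 m p S t"
  shows "comp_mor1 n m p (S, t) (R, s) = (S * R, gauge_comp n m p (S, t) (R, s))"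
proof (cases "n = 0 \<or> m = 0 \<or> p = 0")
  case True
  then have "S * R = 0\<^sub>m p n"
    using is_mor1D(1)[OF f] is_mor1D(1)[OF g] by (intro eq_matI) (auto simp: index_mult_mat_sum)
  then show ?thesis
    using True is_mor1_zero[OF comp_is_mor1[OF f g]] by (simp add: comp_mor1_def)
next
  case False
  then show ?thesis
    by (simp add: comp_mor1_def)
qed

section \<open>Horizontal composition\<close>

definition is_mor2 :: "nat \<Rightarrow> nat \<Rightarrow> nat mat \<Rightarrow> nat mat \<Rightarrow> mor2 \<Rightarrow> bool" where
  "is_mor2 n m R R' T \<longleftrightarrow> T \<in> carrier_mat m n \<and>
    (\<forall>i<m. \<forall>j<n. T $$ (i, j) \<in> carrier_mat (R' $$ (i, j)) (R $$ (i, j)))"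

lemma is_mor2D:
  assumes "is_mor2 n m R R' T"
  shows "T \<in> carrier_mat m n"
    "i < m \<Longrightarrow> j < n \<Longrightarrow> T $$ (i, j) \<in> carrier_mat (R' $$ (i, j)) (R $$ (i, j))"
  using assms by (auto simp: is_mor2_def)

lemma horizontal_carrier:
  fixes \<alpha> \<beta> :: mor2
  assumes "R \<in> carrier_mat m n" "R' \<in> carrier_mat m n" "S \<in> carrier_mat p m" "S' \<in> carrier_mat p m"
    and "is_mor2 n m R R' \<alpha>" "is_mor2 m p S S' \<beta>" "k < p" "j < n"
  shows "dsum m (\<lambda>i. kron (\<beta> $$ (k, i)) (\<alpha> $$ (i, j))) \<in> carrier_mat ((S' * R') $$ (k, j)) ((S * R) $$ (k, j))"
  by (rule dsum_carrier[OF kron_carrier[OF is_mor2D(2)[OF assms(6,7)] is_mor2D(2)[OF assms(5) _ assms(8)] refl refl]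
        index_mult_mat_sum[OF assms(4,2,7,8)] index_mult_mat_sum[OF assms(3,1,7,8)]])

lemma hcomp_entry_carrier:
  assumes f: "is_mor1 n m R s" and f': "is_mor1 n m R' s'" and g: "is_mor1 m p S t" and g': "is_mor1 m p S' t'"
    and \<alpha>: "is_mor2 n m R R' \<alpha>" and \<beta>: "is_mor2 m p S S' \<beta>" and "k < p" "j < n"
  shows "t' (R' *\<^sub>v unit_vec n j) $ k * dsum m (\<lambda>i. kron (\<beta> $$ (k, i)) (\<alpha> $$ (i, j)))
      * minv (t (R *\<^sub>v unit_vec n j) $ k) \<in> carrier_mat ((S' * R') $$ (k, j)) ((S * R) $$ (k, j))"
  using mutual_invD(1)[OF gauge_mutual_inv_unit[OF g' is_mor1D(1)[OF f'] assms(8,7)]]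
    mutual_invD(2)[OF gauge_mutual_inv_unit[OF g is_mor1D(1)[OF f] assms(8,7)]]
    horizontal_carrier[OF is_mor1D(1)[OF f] is_mor1D(1)[OF f'] is_mor1D(1)[OF g] is_mor1D(1)[OF g'] \<alpha> \<beta> assms(7,8)]
  by (auto intro!: mult_carrier_mat)

text \<open>The critical case is \<open>m = 0\<close> with \<open>n\<close> and \<open>p\<close>
  positive: both composite ranks vanish, so every entry is 0 x 0 and agrees with that of
  \<open>zero2\<close>.\<close>

lemma hcomp_mor2_eq:
  assumes f: "is_mor1 n m R s" and f': "is_mor1 n m R' s'" and g: "is_mor1 m p S t" and g': "is_mor1 m p S' t'"
    and \<alpha>: "is_mor2 n m R R' \<alpha>" and \<beta>: "is_mor2 m p S S' \<beta>"
  shows "hcomp_mor2 n m p (S, t) (S', t') (R, s) (R', s') \<beta> \<alpha> = mat p n (\<lambda>(k, j).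
    t' (R' *\<^sub>v unit_vec n j) $ k * dsum m (\<lambda>i. kron (\<beta> $$ (k, i)) (\<alpha> $$ (i, j)))
      * minv (t (R *\<^sub>v unit_vec n j) $ k))"
proof (cases "n = 0 \<or> m = 0 \<or> p = 0")
  case True
  have "t' (R' *\<^sub>v unit_vec n j) $ k * dsum m (\<lambda>i. kron (\<beta> $$ (k, i)) (\<alpha> $$ (i, j)))
      * minv (t (R *\<^sub>v unit_vec n j) $ k) = 1\<^sub>m 0" if "k < p" "j < n" for k j
  proof -
    have "m = 0"
      using True that by auto
    then show ?thesis
      using hcomp_entry_carrier[OF assms that] index_mult_mat_sum[OF is_mor1D(1)[OF g] is_mor1D(1)[OF f] that]
        index_mult_mat_sum[OF is_mor1D(1)[OF g'] is_mor1D(1)[OF f'] that]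
      by (intro carrier_mat_0_eq) simp
  qed
  then show ?thesis
    using True by (intro eq_matI) (auto simp: hcomp_mor2_def zero2_def)
next
  case False
  then show ?thesis
    by (simp add: hcomp_mor2_def)
qed

lemma hcomp_is_mor2:
  assumes "is_mor1 n m R s" "is_mor1 n m R' s'" "is_mor1 m p S t" "is_mor1 m p S' t'"
    and "is_mor2 n m R R' \<alpha>" "is_mor2 m p S S' \<beta>"
  shows "is_mor2 n p (S * R) (S' * R') (hcomp_mor2 n m p (S, t) (S', t') (R, s) (R', s') \<beta> \<alpha>)"
  using hcomp_entry_carrier[OF assms] by (simp add: is_mor2_def hcomp_mor2_eq[OF assms])

lemma id_mor2_is_mor2: "is_mor2 n m R R (id_mor2 n m (R, s))"
  by (simp add: is_mor2_def id_mor2_eq)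

lemma vcomp_is_mor2:
  assumes "is_mor2 n m R R' \<alpha>" "is_mor2 n m R' R'' \<beta>"
  shows "is_mor2 n m R R'' (vcomp_mor2 n m f f' f'' \<beta> \<alpha>)"
  using is_mor2D[OF assms(1)] is_mor2D[OF assms(2)]
  by (auto simp: is_mor2_def vcomp_mor2_eq intro!: mult_carrier_mat)

text \<open>The middle factor is an identity, so the gauge value meets its inverse.\<close>

lemma hcomp_id_mor2:
  assumes f: "is_mor1 n m R s" and g: "is_mor1 m p S t"
  shows "hcomp_mor2 n m p (S, t) (S, t) (R, s) (R, s) (id_mor2 m p (S, t)) (id_mor2 n m (R, s))
    = id_mor2 n p (comp_mor1 n m p (S, t) (R, s))"
  unfolding hcomp_mor2_eq[OF f f g g id_mor2_is_mor2 id_mor2_is_mor2] comp_mor1_eq[OF f g] id_mor2_eq[of n p]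
proof (rule eq_matI; simp)
  fix k j assume kj: "k < p" "j < n"
  have "dsum m (\<lambda>i. kron (id_mor2 m p (S, t) $$ (k, i)) (id_mor2 n m (R, s) $$ (i, j)))
    = dsum m (\<lambda>i. 1\<^sub>m (S $$ (k, i) * R $$ (i, j)))"
    using kj by (intro dsum_cong) (auto simp: id_mor2_eq kron_one)
  also have "\<dots> = 1\<^sub>m ((S * R) $$ (k, j))"
    unfolding index_mult_mat_sum[OF is_mor1D(1)[OF g] is_mor1D(1)[OF f] kj] by (rule dsum_one)
  finally show "t (R *\<^sub>v unit_vec n j) $ k
      * dsum m (\<lambda>i. kron (id_mor2 m p (S, t) $$ (k, i)) (id_mor2 n m (R, s) $$ (i, j)))
      * minv (t (R *\<^sub>v unit_vec n j) $ k) = 1\<^sub>m ((S * R) $$ (k, j))"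
    using mutual_invD[OF gauge_mutual_inv_unit[OF g is_mor1D(1)[OF f] kj(2,1)]] by simp
qed

lemma hcomp_id_left:
  assumes f: "is_mor1 n m R s" and f': "is_mor1 n m R' s'" and \<alpha>: "is_mor2 n m R R' \<alpha>"
  shows "hcomp_mor2 n m m (id_mor1 m) (id_mor1 m) (R, s) (R', s') (id_mor2 m m (id_mor1 m)) \<alpha> = \<alpha>"
  unfolding id_mor1_eq
    hcomp_mor2_eq[OF f f' trivial_is_mor1[OF one_carrier_mat] trivial_is_mor1[OF one_carrier_mat] \<alpha> id_mor2_is_mor2]
proof (rule eq_matI)
  fix k j assume "k < dim_row \<alpha>" "j < dim_col \<alpha>"
  then have kj: "k < m" "j < n"
    using is_mor2D(1)[OF \<alpha>] by auto
  have t: "trivial_gauge (1\<^sub>m m) (Q *\<^sub>v unit_vec n j) $ k = 1\<^sub>m (Q $$ (k, j))" if "Q \<in> carrier_mat m n" for Q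
    using that kj by (simp add: trivial_gauge_def rank_unit)
  have "dsum m (\<lambda>i. kron (id_mor2 m m (1\<^sub>m m, trivial_gauge (1\<^sub>m m)) $$ (k, i)) (\<alpha> $$ (i, j))) = \<alpha> $$ (k, j)"
    using kj by (subst dsum_single[of k]) (auto simp: id_mor2_eq kron_def[of "1\<^sub>m 0"])
  with kj is_mor2D(2)[OF \<alpha> kj] t[OF is_mor1D(1)[OF f]] t[OF is_mor1D(1)[OF f']]
  show "mat m n (\<lambda>(k, j). trivial_gauge (1\<^sub>m m) (R' *\<^sub>v unit_vec n j) $ k
      * dsum m (\<lambda>i. kron (id_mor2 m m (1\<^sub>m m, trivial_gauge (1\<^sub>m m)) $$ (k, i)) (\<alpha> $$ (i, j)))
      * minv (trivial_gauge (1\<^sub>m m) (R *\<^sub>v unit_vec n j) $ k)) $$ (k, j) = \<alpha> $$ (k, j)"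
    by simp
qed (use is_mor2D(1)[OF \<alpha>] in auto)

text \<open>The gauges are evaluated at unit vectors, where the normalisation makes them
  identities.\<close>

lemma hcomp_id_right:
  assumes f: "is_mor1 n m R s" and f': "is_mor1 n m R' s'" and \<alpha>: "is_mor2 n m R R' \<alpha>"
  shows "hcomp_mor2 n n m (R, s) (R', s') (id_mor1 n) (id_mor1 n) \<alpha> (id_mor2 n n (id_mor1 n)) = \<alpha>"
  unfolding id_mor1_eq
    hcomp_mor2_eq[OF trivial_is_mor1[OF one_carrier_mat] trivial_is_mor1[OF one_carrier_mat] f f' id_mor2_is_mor2 \<alpha>]
proof (rule eq_matI)
  fix k j assume "k < dim_row \<alpha>" "j < dim_col \<alpha>"
  then have kj: "k < m" "j < n"
    using is_mor2D(1)[OF \<alpha>] by auto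
  have "dsum n (\<lambda>i. kron (\<alpha> $$ (k, i)) (id_mor2 n n (1\<^sub>m n, trivial_gauge (1\<^sub>m n)) $$ (i, j))) = \<alpha> $$ (k, j)"
    using kj by (subst dsum_single[of j]) (auto simp: id_mor2_eq kron_def[of _ "1\<^sub>m 0"])
  with kj is_mor2D(2)[OF \<alpha> kj] is_mor1D(4)[OF f kj] is_mor1D(4)[OF f' kj]
  show "mat m n (\<lambda>(k, j). s' (1\<^sub>m n *\<^sub>v unit_vec n j) $ k
      * dsum n (\<lambda>i. kron (\<alpha> $$ (k, i)) (id_mor2 n n (1\<^sub>m n, trivial_gauge (1\<^sub>m n)) $$ (i, j)))
      * minv (s (1\<^sub>m n *\<^sub>v unit_vec n j) $ k)) $$ (k, j) = \<alpha> $$ (k, j)"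
    by simp
qed (use is_mor2D(1)[OF \<alpha>] in auto)

text \<open>The gauge factors of the intermediate composite meet as an inverse pair, and the middle
  sums multiply by the mixed product property.\<close>

lemma hcomp_interchange:
  assumes f: "is_mor1 n m R s" and f': "is_mor1 n m R' s'" and f'': "is_mor1 n m R'' s''"
    and g: "is_mor1 m p S t" and g': "is_mor1 m p S' t'" and g'': "is_mor1 m p S'' t''"
    and \<alpha>: "is_mor2 n m R R' \<alpha>" and \<alpha>': "is_mor2 n m R' R'' \<alpha>'"
    and \<beta>: "is_mor2 m p S S' \<beta>" and \<beta>': "is_mor2 m p S' S'' \<beta>'"
  shows "hcomp_mor2 n m p (S, t) (S'', t'') (R, s) (R'', s'')
      (vcomp_mor2 m p u u' u'' \<beta>' \<beta>) (vcomp_mor2 n m v v' v'' \<alpha>' \<alpha>)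
    = vcomp_mor2 n p x x' x''
      (hcomp_mor2 n m p (S', t') (S'', t'') (R', s') (R'', s'') \<beta>' \<alpha>')
      (hcomp_mor2 n m p (S, t) (S', t') (R, s) (R', s') \<beta> \<alpha>)"
  unfolding hcomp_mor2_eq[OF f f'' g g'' vcomp_is_mor2[OF \<alpha> \<alpha>'] vcomp_is_mor2[OF \<beta> \<beta>']]
    hcomp_mor2_eq[OF f f' g g' \<alpha> \<beta>] hcomp_mor2_eq[OF f' f'' g' g'' \<alpha>' \<beta>'] vcomp_mor2_eq[of n p]
proof (rule eq_matI; simp)
  fix k j assume kj: "k < p" "j < n"
  note R = is_mor1D(1)[OF f] and R' = is_mor1D(1)[OF f'] and R'' = is_mor1D(1)[OF f'']
    and S = is_mor1D(1)[OF g] and S' = is_mor1D(1)[OF g'] and S'' = is_mor1D(1)[OF g'']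
  define W where "W = minv (t (R *\<^sub>v unit_vec n j) $ k)"
  define W' where "W' = t' (R' *\<^sub>v unit_vec n j) $ k"
  define W'' where "W'' = t'' (R'' *\<^sub>v unit_vec n j) $ k"
  define M where "M = dsum m (\<lambda>i. kron (\<beta> $$ (k, i)) (\<alpha> $$ (i, j)))"
  define M' where "M' = dsum m (\<lambda>i. kron (\<beta>' $$ (k, i)) (\<alpha>' $$ (i, j)))"
  let ?c = "(S * R) $$ (k, j)" and ?c' = "(S' * R') $$ (k, j)" and ?c'' = "(S'' * R'') $$ (k, j)"
  have W: "W \<in> carrier_mat ?c ?c" and W': "mutual_inv ?c' W' (minv W')" and W'': "W'' \<in> carrier_mat ?c'' ?c''"
    using mutual_invD(2)[OF gauge_mutual_inv_unit[OF g R kj(2,1)]] gauge_mutual_inv_unit[OF g' R' kj(2,1)]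
      mutual_invD(1)[OF gauge_mutual_inv_unit[OF g'' R'' kj(2,1)]] by (auto simp: W_def W'_def W''_def)
  have M: "M \<in> carrier_mat ?c' ?c" and M': "M' \<in> carrier_mat ?c'' ?c'"
    unfolding M_def M'_def by (rule horizontal_carrier[OF R R' S S' \<alpha> \<beta> kj] horizontal_carrier[OF R' R'' S' S'' \<alpha>' \<beta>' kj])+
  have "dsum m (\<lambda>i. kron (vcomp_mor2 m p u u' u'' \<beta>' \<beta> $$ (k, i)) (vcomp_mor2 n m v v' v'' \<alpha>' \<alpha> $$ (i, j)))
      = dsum m (\<lambda>i. kron (\<beta>' $$ (k, i) * \<beta> $$ (k, i)) (\<alpha>' $$ (i, j) * \<alpha> $$ (i, j)))"
    using kj by (intro dsum_cong) (auto simp: vcomp_mor2_eq)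
  also have "\<dots> = M' * M"
    unfolding M_def M'_def
    by (rule dsum_kron_mult[OF is_mor2D(2)[OF \<beta>' kj(1)] is_mor2D(2)[OF \<beta> kj(1)]
          is_mor2D(2)[OF \<alpha>' _ kj(2)] is_mor2D(2)[OF \<alpha> _ kj(2)], symmetric])
  finally have *: "dsum m (\<lambda>i. kron (vcomp_mor2 m p u u' u'' \<beta>' \<beta> $$ (k, i))
      (vcomp_mor2 n m v v' v'' \<alpha>' \<alpha> $$ (i, j))) = M' * M" .
  note dims = carrier_matD[OF W] carrier_matD[OF W''] carrier_matD[OF M] carrier_matD[OF M'] mutual_invD(5-8)[OF W']
  have "W'' * (M' * M) * W = W'' * M' * minv W' * (W' * M * W)"
    by (simp add: assoc_mult_mat_dim dims mutual_inv_cancel(2)[OF W'] del: assoc_mult_mat)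
  then show "t'' (R'' *\<^sub>v unit_vec n j) $ k
      * dsum m (\<lambda>i. kron (vcomp_mor2 m p u u' u'' \<beta>' \<beta> $$ (k, i)) (vcomp_mor2 n m v v' v'' \<alpha>' \<alpha> $$ (i, j)))
      * minv (t (R *\<^sub>v unit_vec n j) $ k)
    = t'' (R'' *\<^sub>v unit_vec n j) $ k * dsum m (\<lambda>i. kron (\<beta>' $$ (k, i)) (\<alpha>' $$ (i, j)))
      * minv (t' (R' *\<^sub>v unit_vec n j) $ k)
      * (t' (R' *\<^sub>v unit_vec n j) $ k * dsum m (\<lambda>i. kron (\<beta> $$ (k, i)) (\<alpha> $$ (i, j)))
      * minv (t (R *\<^sub>v unit_vec n j) $ k))"
    unfolding * by (simp only: W_def W'_def W''_def M_def M'_def)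
qed

text \<open>Once \<open>F'\<close>, \<open>G'\<close> and \<open>F\<close>, \<open>G\<close> have
  cancelled, both sides are \<open>W' D' _ D W\<close>, with \<open>P' M1 (minv P)\<close> in the
  middle on one side and \<open>M2\<close> on the other. Naturality identifies these two.\<close>

lemma hcomp_assoc:
  assumes f: "is_mor1 n m R s" and f': "is_mor1 n m R' s'"
    and g: "is_mor1 m p S t" and g': "is_mor1 m p S' t'"
    and h: "is_mor1 p q T w" and h': "is_mor1 p q T' w'"
    and \<alpha>: "is_mor2 n m R R' \<alpha>" and \<beta>: "is_mor2 m p S S' \<beta>" and \<gamma>: "is_mor2 p q T T' \<gamma>"
  shows "hcomp_mor2 n m q (T * S, gauge_comp m p q (T, w) (S, t)) (T' * S', gauge_comp m p q (T', w') (S', t'))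
      (R, s) (R', s') (hcomp_mor2 m p q (T, w) (T', w') (S, t) (S', t') \<gamma> \<beta>) \<alpha>
    = hcomp_mor2 n p q (T, w) (T', w') (S * R, gauge_comp n m p (S, t) (R, s))
      (S' * R', gauge_comp n m p (S', t') (R', s')) \<gamma> (hcomp_mor2 n m p (S, t) (S', t') (R, s) (R', s') \<beta> \<alpha>)"
  unfolding
    hcomp_mor2_eq[OF f f' comp_is_mor1[OF g h] comp_is_mor1[OF g' h'] \<alpha> hcomp_is_mor2[OF g g' h h' \<beta> \<gamma>]]
    hcomp_mor2_eq[OF comp_is_mor1[OF f g] comp_is_mor1[OF f' g'] h h' hcomp_is_mor2[OF f f' g g' \<alpha> \<beta>] \<gamma>]
proof (rule eq_matI; simp only: dim_row_mat dim_col_mat index_mat split)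
  fix l j assume lj: "l < q" "j < n"
  note R = is_mor1D(1)[OF f] and R' = is_mor1D(1)[OF f'] and S = is_mor1D(1)[OF g]
    and S' = is_mor1D(1)[OF g'] and T = is_mor1D(1)[OF h] and T' = is_mor1D(1)[OF h']
  let ?b = "R *\<^sub>v unit_vec n j" and ?b' = "R' *\<^sub>v unit_vec n j"
  let ?r = "row T l" and ?r' = "row T' l"
  define N where "N = (T * S * R) $$ (l, j)"
  define N' where "N' = (T' * S' * R') $$ (l, j)"
  have b: "?b \<in> carrier_vec m" "?b' \<in> carrier_vec m"
    using R R' by auto
  have b_i: "?b $ i = R $$ (i, j)" "?b' $ i = R' $$ (i, j)" if "i < m" for i
    using rank_unit[OF R that lj(2)] rank_unit[OF R' that lj(2)] by auto
  have r: "?r \<in> carrier_vec p" "?r' \<in> carrier_vec p"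
    using T T' by auto
  have r_k: "?r $ k = T $$ (l, k)" "?r' $ k = T' $$ (l, k)" if "k < p" for k
    using T T' lj that by auto

  define K where "K i = dsum p (\<lambda>k. kron (\<gamma> $$ (l, k)) (\<beta> $$ (k, i)))" for i
  define X where "X k = dsum m (\<lambda>i. kron (\<beta> $$ (k, i)) (\<alpha> $$ (i, j)))" for k
  define W where "W = minv (w (S *\<^sub>v ?b) $ l)"
  define W' where "W' = w' (S' *\<^sub>v ?b') $ l"
  define D where "D = dsum p (\<lambda>k. kron (1\<^sub>m (T $$ (l, k))) (minv (t ?b $ k)))"
  define D' where "D' = dsum p (\<lambda>k. kron (1\<^sub>m (T' $$ (l, k))) (t' ?b' $ k))"
  define P where "P = perm_mat ?r S ?b"
  define P' where "P' = perm_mat ?r' S' ?b'"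
  define G where "G = dsum m (\<lambda>i. kron (w (S *\<^sub>v unit_vec m i) $ l) (1\<^sub>m (?b $ i)))"
  define F where "F = dsum m (\<lambda>i. kron (minv (w (S *\<^sub>v unit_vec m i) $ l)) (1\<^sub>m (?b $ i)))"
  define G' where "G' = dsum m (\<lambda>i. kron (w' (S' *\<^sub>v unit_vec m i) $ l) (1\<^sub>m (?b' $ i)))"
  define F' where "F' = dsum m (\<lambda>i. kron (minv (w' (S' *\<^sub>v unit_vec m i) $ l)) (1\<^sub>m (?b' $ i)))"
  define M1 where "M1 = dsum m (\<lambda>i. kron (K i) (\<alpha> $$ (i, j)))"
  define M2 where "M2 = dsum p (\<lambda>k. kron (\<gamma> $$ (l, k)) (X k))"

  have K: "K i \<in> carrier_mat ((T' * S') $$ (l, i)) ((T * S) $$ (l, i))" if "i < m" for i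
    unfolding K_def by (rule horizontal_carrier[OF S S' T T' \<beta> \<gamma> lj(1) that])
  have X: "X k \<in> carrier_mat ((S' * R') $$ (k, j)) ((S * R) $$ (k, j))" if "k < p" for k
    unfolding X_def by (rule horizontal_carrier[OF R R' S S' \<alpha> \<beta> that lj(2)])
  have wSe: "mutual_inv ((T * S) $$ (l, i)) (w (S *\<^sub>v unit_vec m i) $ l) (minv (w (S *\<^sub>v unit_vec m i) $ l))"
    if "i < m" for i
    by (rule gauge_mutual_inv_unit[OF h S that lj(1)])
  have wSe': "mutual_inv ((T' * S') $$ (l, i)) (w' (S' *\<^sub>v unit_vec m i) $ l) (minv (w' (S' *\<^sub>v unit_vec m i) $ l))"
    if "i < m" for i
    by (rule gauge_mutual_inv_unit[OF h' S' that lj(1)])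
  have tb: "mutual_inv ((S * R) $$ (k, j)) (t ?b $ k) (minv (t ?b $ k))" if "k < p" for k
    by (rule gauge_mutual_inv_unit[OF g R lj(2) that])
  have tb': "mutual_inv ((S' * R') $$ (k, j)) (t' ?b' $ k) (minv (t' ?b' $ k))" if "k < p" for k
    by (rule gauge_mutual_inv_unit[OF g' R' lj(2) that])
  have assoc_rank: "T * S * R = T * (S * R)" "T' * S' * R' = T' * (S' * R')"
    using R S T R' S' T' by auto
  have N: "N = (\<Sum>i<m. (T * S) $$ (l, i) * ?b $ i)" "N = (\<Sum>k<p. T $$ (l, k) * (S * R) $$ (k, j))"
    using index_mult_mat_sum[OF mult_carrier_mat[OF T S] R lj] index_mult_mat_sum[OF T mult_carrier_mat[OF S R] lj] b_i
    by (simp_all add: N_def assoc_rank)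
  have N': "N' = (\<Sum>i<m. (T' * S') $$ (l, i) * ?b' $ i)" "N' = (\<Sum>k<p. T' $$ (l, k) * (S' * R') $$ (k, j))"
    using index_mult_mat_sum[OF mult_carrier_mat[OF T' S'] R' lj] index_mult_mat_sum[OF T' mult_carrier_mat[OF S' R'] lj] b_i
    by (simp_all add: N'_def assoc_rank)
  have NP: "N = (\<Sum>k<p. ?r $ k * (\<Sum>i<m. S $$ (k, i) * ?b $ i))"
    using index_mult_mat_sum[OF S R _ lj(2)] by (simp add: N(2) r_k b_i)
  have NP': "N' = (\<Sum>k<p. ?r' $ k * (\<Sum>i<m. S' $$ (k, i) * ?b' $ i))"
    using index_mult_mat_sum[OF S' R' _ lj(2)] by (simp add: N'(2) r_k b_i)
  have W: "W \<in> carrier_mat N N"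
    unfolding W_def N_def using mutual_invD(2)[OF gauge_mutual_inv_unit[OF h mult_carrier_mat[OF S R] lj(2,1)]]
      R S T by simp
  have W': "W' \<in> carrier_mat N' N'"
    unfolding W'_def N'_def using mutual_invD(1)[OF gauge_mutual_inv_unit[OF h' mult_carrier_mat[OF S' R'] lj(2,1)]]
      R' S' T' by simp
  have D: "D \<in> carrier_mat N N"
    unfolding D_def by (rule dsum_carrier[OF kron_carrier[OF one_carrier_mat mutual_invD(2)[OF tb] refl refl] N(2) N(2)])
  have D': "D' \<in> carrier_mat N' N'"
    unfolding D'_def by (rule dsum_carrier[OF kron_carrier[OF one_carrier_mat mutual_invD(1)[OF tb'] refl refl] N'(2) N'(2)])
  have P: "mutual_inv N P (minv P)"
    unfolding P_def by (rule perm_mat_mutual_inv[OF r(1) S b(1) NP])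
  have P': "mutual_inv N' P' (minv P')"
    unfolding P'_def by (rule perm_mat_mutual_inv[OF r(2) S' b(2) NP'])
  have G: "mutual_inv N G F"
    unfolding G_def F_def by (rule mutual_inv_dsum[OF mutual_inv_kron[OF wSe mutual_inv_one refl] N(1)])
  have G': "mutual_inv N' G' F'"
    unfolding G'_def F'_def by (rule mutual_inv_dsum[OF mutual_inv_kron[OF wSe' mutual_inv_one refl] N'(1)])
  have \<alpha>_b: "\<alpha> $$ (i, j) \<in> carrier_mat (?b' $ i) (?b $ i)" if "i < m" for i
    using is_mor2D(2)[OF \<alpha> that lj(2)] b_i[OF that] by simp
  have M1: "M1 \<in> carrier_mat N' N"
    unfolding M1_def by (rule dsum_carrier[OF kron_carrier[OF K \<alpha>_b refl refl] N'(1) N(1)])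
  have M2: "M2 \<in> carrier_mat N' N"
    unfolding M2_def
    by (rule dsum_carrier[OF kron_carrier[OF is_mor2D(2)[OF \<gamma> lj(1)] X refl refl] N'(2) N(2)])
  note dims = carrier_matD[OF W] carrier_matD[OF W'] carrier_matD[OF D] carrier_matD[OF D']
    carrier_matD[OF M1] carrier_matD[OF M2] mutual_invD(5-8)[OF P] mutual_invD(5-8)[OF P']
    mutual_invD(5-8)[OF G] mutual_invD(5-8)[OF G']

  \<comment> \<open>The rectangular form of naturality: \<gamma>, \<beta> and column
    \<open>j\<close> of \<alpha> take the places of \<open>X\<close>, \<open>Y\<close> and
    \<open>M\<close>, with the \<open>j\<close>-th columns of \<open>R\<close> and \<open>R'\<close>
    as vectors.\<close>
  have natural: "P' * M1 = M2 * P"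
    unfolding P_def P'_def M1_def M2_def K_def X_def
    by (rule perm_mat_natural[OF r(1) S b(1) r(2) S' b(2)])
      (use is_mor2D(2)[OF \<gamma> lj(1)] is_mor2D(2)[OF \<beta>] \<alpha>_b r_k in simp_all)

  have gc: "gauge_comp m p q (T', w') (S', t') ?b' $ l = W' * D' * P' * F'"
    unfolding gauge_comp_index[OF b(2) lj(1)] W'_def D'_def P'_def F'_def ..
  have gc_inv: "minv (gauge_comp m p q (T, w) (S, t) ?b $ l) = G * (minv P * (D * W))"
    unfolding minv_gauge_comp[OF g h b(1) lj(1)] W_def D_def P_def G_def ..
  have mid: "dsum m (\<lambda>i. kron (hcomp_mor2 m p q (T, w) (T', w') (S, t) (S', t') \<gamma> \<beta> $$ (l, i)) (\<alpha> $$ (i, j)))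
      = G' * M1 * F"
  proof -
    have "dsum m (\<lambda>i. kron (hcomp_mor2 m p q (T, w) (T', w') (S, t) (S', t') \<gamma> \<beta> $$ (l, i)) (\<alpha> $$ (i, j)))
      = dsum m (\<lambda>i. kron (w' (S' *\<^sub>v unit_vec m i) $ l * K i * minv (w (S *\<^sub>v unit_vec m i) $ l)) (\<alpha> $$ (i, j)))"
      using lj by (intro dsum_cong) (simp_all add: hcomp_mor2_eq[OF g g' h h' \<beta> \<gamma>] K_def)
    also have "\<dots> = G' * M1 * F"
      unfolding G'_def M1_def F_def
      by (rule dsum_kron_sandwich_left[OF mutual_invD(1)[OF wSe'] K mutual_invD(2)[OF wSe] \<alpha>_b])
    finally show ?thesis .
  qed
  have mid': "dsum p (\<lambda>k. kron (\<gamma> $$ (l, k)) (hcomp_mor2 n m p (S, t) (S', t') (R, s) (R', s') \<beta> \<alpha> $$ (k, j)))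
      = D' * M2 * D"
  proof -
    have "dsum p (\<lambda>k. kron (\<gamma> $$ (l, k)) (hcomp_mor2 n m p (S, t) (S', t') (R, s) (R', s') \<beta> \<alpha> $$ (k, j)))
      = dsum p (\<lambda>k. kron (\<gamma> $$ (l, k)) (t' ?b' $ k * X k * minv (t ?b $ k)))"
      using lj by (intro dsum_cong) (simp_all add: hcomp_mor2_eq[OF f f' g g' \<alpha> \<beta>] X_def)
    also have "\<dots> = D' * M2 * D"
      unfolding D'_def M2_def D_def
      by (rule dsum_kron_sandwich_right[OF mutual_invD(1)[OF tb'] X mutual_invD(2)[OF tb] is_mor2D(2)[OF \<gamma> lj(1)]])
    finally show ?thesis .
  qed

  have "W' * D' * P' * F' * (G' * M1 * F) * (G * (minv P * (D * W))) = W' * D' * (P' * M1) * minv P * D * W"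
    by (simp add: assoc_mult_mat_dim dims mutual_inv_cancel[OF G] mutual_inv_cancel[OF G'] del: assoc_mult_mat)
  also have "\<dots> = W' * (D' * M2 * D) * W"
    unfolding natural by (simp add: assoc_mult_mat_dim dims mutual_inv_cancel[OF P] del: assoc_mult_mat)
  finally show "gauge_comp m p q (T', w') (S', t') ?b' $ l
      * dsum m (\<lambda>i. kron (hcomp_mor2 m p q (T, w) (T', w') (S, t) (S', t') \<gamma> \<beta> $$ (l, i)) (\<alpha> $$ (i, j)))
      * minv (gauge_comp m p q (T, w) (S, t) ?b $ l)
    = w' (S' * R' *\<^sub>v unit_vec n j) $ l
      * dsum p (\<lambda>k. kron (\<gamma> $$ (l, k)) (hcomp_mor2 n m p (S, t) (S', t') (R, s) (R', s') \<beta> \<alpha> $$ (k, j)))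
      * minv (w (S * R *\<^sub>v unit_vec n j) $ l)"
    unfolding gc gc_inv mid mid' using R S R' S' by (simp add: W_def W'_def del: assoc_mult_mat)
qed

section \<open>Vertical composition and the axioms\<close>

lemma vcomp_mor2_assoc:
  assumes "is_mor2 n m R R' \<alpha>" "is_mor2 n m R' R'' \<beta>" "is_mor2 n m R'' R''' \<gamma>"
  shows "vcomp_mor2 n m f f' f''' (vcomp_mor2 n m f' f'' f''' \<gamma> \<beta>) \<alpha>
    = vcomp_mor2 n m f f'' f''' \<gamma> (vcomp_mor2 n m f f' f'' \<beta> \<alpha>)"
  using assoc_mult_mat[OF is_mor2D(2)[OF assms(3)] is_mor2D(2)[OF assms(2)] is_mor2D(2)[OF assms(1)]]
  by (intro eq_matI) (simp_all add: vcomp_mor2_eq)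

lemma vcomp_mor2_id:
  assumes "is_mor2 n m R R' \<alpha>"
  shows "vcomp_mor2 n m f f' f'' (id_mor2 n m (R', s')) \<alpha> = \<alpha>"
    and "vcomp_mor2 n m f f' f'' \<alpha> (id_mor2 n m (R, s)) = \<alpha>"
  using is_mor2D(1)[OF assms] left_mult_one_mat[OF is_mor2D(2)[OF assms]] right_mult_one_mat[OF is_mor2D(2)[OF assms]]
  by (auto simp: vcomp_mor2_eq id_mor2_eq intro!: eq_matI)

lemma mem_hom1: "(R, s) \<in> hom1 n m \<longleftrightarrow> is_mor1 n m R s"
  by (simp add: hom1_iff)

lemma mem_hom2: "T \<in> hom2 n m (R, s) (R', s') \<longleftrightarrow> is_mor2 n m R R' T"
  by (simp add: hom2_iff is_mor2_def)

theorem mainTheorem9: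
  shows "strict_2_category (UNIV :: nat set) hom1 hom2
           id_mor1 comp_mor1 id_mor2 vcomp_mor2 hcomp_mor2"
  \<comment> \<open>Morphisms are split into pairs and memberships become \<open>is_mor1\<close> and
    \<open>is_mor2\<close>, so the object 0 needs no separate treatment.\<close>
  apply (unfold_locales; (simp only: split_paired_all mem_hom1 mem_hom2)?)
  subgoal by (simp add: id_mor1_eq mem_hom1 trivial_is_mor1)
  subgoal by (simp add: comp_mor1_eq comp_is_mor1 mem_hom1)
  subgoal by (simp add: comp_mor1_eq comp_is_mor1 gauge_comp_assoc assoc_mult_mat[OF is_mor1D(1) is_mor1D(1) is_mor1D(1)])
  subgoal by (simp add: comp_mor1_eq id_mor1_eq trivial_is_mor1 gauge_comp_id_left left_mult_one_mat[OF is_mor1D(1)])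
  subgoal by (simp add: comp_mor1_eq id_mor1_eq trivial_is_mor1 gauge_comp_id_right right_mult_one_mat[OF is_mor1D(1)])
  subgoal by (rule id_mor2_is_mor2)
  subgoal by (rule vcomp_is_mor2)
  subgoal by (rule vcomp_mor2_assoc)
  subgoal by (rule vcomp_mor2_id)
  subgoal by (rule vcomp_mor2_id)
  subgoal by (simp add: comp_mor1_eq mem_hom2 hcomp_is_mor2)
  subgoal by (rule hcomp_id_mor2)
  subgoal by (rule hcomp_interchange)
  subgoal by (simp add: comp_mor1_eq hcomp_assoc)
  subgoal by (rule hcomp_id_left)
  subgoal by (rule hcomp_id_right)
  done

end
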